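(* Let $n \ge 2$. For real $t > 0$ consider the signed measures $\nu_{n,-t}^{\ast}$ on $S_n$. Then: (1) For every real $t > 0$ with $t(t+1) > n-2$, $\nu_{n,-t}^{\ast}(g) > 0$ for all $g \in S_n$, so $\nu_{n,-t}^{\ast}$ is a probability measure on $S_n$ with full support. (2) For every integer $k \ge 1$ with $k(k+1) \le n-2$, $\nu_{n,-k}^{\ast}(g) \ge 0$ for all $g \in S_n$, so $\nu_{n,-k}^{\ast}$ is a probability measure on $S_n$; it does not have full support: it vanishes on the conjugacy class $C_\mu$ with $\mu = \langle 2^{n/2}\rangle$ if $n$ is even, and with $\mu = \langle 1, 2^{(n-1)/2}\rangle$ if $n$ is odd. (3) For every $g \in S_n$, $\lim_{t\to\infty} \nu_{n,-t}^{\ast}(g) = \frac{1}{n!}$.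
   Context: For $m\ge1$, $M_m(X) = \frac{1}{m}\sum_{d\mid m}\mu(d)X^{m/d}$ ($\mu(d)$ the Möbius function); $\binom{w}{k} = \frac{w(w-1)\cdots(w-k+1)}{k!}$; for a partition $\mu$ of $n$, $c_i(\mu)$ is the number of parts equal to $i$ and $C_\mu\subset S_n$ is the conjugacy class of cycle type $\mu$. For $z \in \mathbb{C}\setminus\{0,1\}$, $\nu_{n,z}^{\ast}(C_\mu) = \frac{1}{z^{n-1}(z-1)}\prod_{i=1}^n\binom{M_i(z)}{c_i(\mu)}$ and $\nu_{n,z}^{\ast}(g) = \nu_{n,z}^{\ast}(C_\mu)/|C_\mu|$ for $g\in C_\mu$. Bracket notation $\langle 1^{a_1}, 2^{a_2},\dots\rangle$ denotes the partition with $a_i$ parts equal to $i$.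
   Formalization: In part (1) the formal statement additionally requires t > 1 when n = 3; without this the claim is false, since ν*_{3,-t}(C_⟨3⟩) = (t-1)/(3t) is not positive for t ≤ 1, although t(t+1) > 1 holds for t > (√5-1)/2. *)

theory Defs
  imports
    "HOL-Probability.Probability_Mass_Function"
    "HOL-Combinatorics.Orbits"
    "HOL-Computational_Algebra.Squarefree"
begin

definition moebius_mu :: "nat \<Rightarrow> int" where
  "moebius_mu d = (if squarefree d then (-1) ^ card (prime_factors d) else 0)"

definition necklace :: "nat \<Rightarrow> complex \<Rightarrow> complex" where
  "necklace m z = (\<Sum>d | d dvd m. of_int (moebius_mu d) * z ^ (m div d)) / of_nat m"

definition Sn :: "nat \<Rightarrow> (nat \<Rightarrow> nat) set" where
  "Sn n = {g. g permutes {1..n}}"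

text \<open>A partition of \<open>n\<close> is the multiset of its (positive) parts, so \<open>c\<^sub>i(\<mu>)\<close> is
  \<open>count \<mu> i\<close>. The cycles of \<open>g\<close>, fixed points included, are its orbits on \<open>{1..n}\<close>.\<close>

definition cycle_type :: "nat \<Rightarrow> (nat \<Rightarrow> nat) \<Rightarrow> nat multiset" where
  "cycle_type n g = image_mset card (mset_set (orbit g ` {1..n}))"

definition conj_class :: "nat \<Rightarrow> nat multiset \<Rightarrow> (nat \<Rightarrow> nat) set" where
  "conj_class n \<mu> = {g \<in> Sn n. cycle_type n g = \<mu>}"

definition nu_class :: "nat \<Rightarrow> complex \<Rightarrow> nat multiset \<Rightarrow> complex" where
  "nu_class n z \<mu> =
     1 / (z ^ (n - 1) * (z - 1)) * (\<Prod>i = 1..n. necklace i z gchoose count \<mu> i)"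

definition nu :: "nat \<Rightarrow> complex \<Rightarrow> (nat \<Rightarrow> nat) \<Rightarrow> complex" where
  "nu n z g = nu_class n z (cycle_type n g) / of_nat (card (conj_class n (cycle_type n g)))"

definition is_pmf_of_nu :: "nat \<Rightarrow> complex \<Rightarrow> (nat \<Rightarrow> nat) pmf \<Rightarrow> bool" where
  "is_pmf_of_nu n z p \<longleftrightarrow>
     set_pmf p \<subseteq> Sn n \<and> (\<forall>g \<in> Sn n. nu n z g = complex_of_real (pmf p g))"

end

theory Submission
  imports Defs "HOL-Computational_Algebra.Formal_Laurent_Series" "HOL-Real_Asymp.Real_Asymp"
begin

unbundle no vec_syntax

text \<open>
  Write \<open>P\<^sub>m(z) = m M\<^sub>m(z)\<close>. As the numbers \<open>i c\<^sub>i\<close> add up to \<open>n\<close>, the sign of the prefactor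
  \<open>1 / (z\<^bsup>n-1\<^esup> (z - 1))\<close> at \<open>z = -t\<close> is absorbed by giving each binomial the sign \<open>(-1)\<^bsup>i c\<^sub>i\<^esup>\<close>.
  Positivity then requires \<open>P\<^sub>i(-t) < 0\<close> for odd \<open>i\<close> and \<open>P\<^sub>i(-t) > i (c\<^sub>i - 1)\<close> for even \<open>i\<close>,
  the extreme case being \<open>P\<^sub>2(-t) = t(t+1)\<close>. Now \<open>P\<^sub>m(-t) = -P\<^sub>m(t)\<close> for odd \<open>m\<close>, and \<open>P\<^sub>2\<^sub>m(-t)\<close> is
  \<open>P\<^sub>m(t\<^sup>2)\<close>, plus \<open>P\<^sub>m(t)\<close> if \<open>m\<close> is odd, so it suffices to bound \<open>P\<^sub>m\<close> from below on \<open>[1, \<infinity>)\<close>. The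
  Taylor coefficients of \<open>P\<^sub>m(e\<^sup>y)\<close> are \<open>J\<^sub>k(m) / k!\<close> with Jordan's totients \<open>J\<^sub>k\<close>, and
  \<open>J\<^sub>k(m) \<ge> J\<^sub>k(2)\<close> for \<open>m \<ge> 2\<close>; hence \<open>P\<^sub>m(x) \<ge> P\<^sub>2(x) = x\<^sup>2 - x\<close>.

  At a negative integer the \<open>M\<^sub>i\<close> with \<open>i\<close> even are nonnegative integers, so their binomials are
  nonnegative, and the one for \<open>i = 2\<close> vanishes as soon as \<open>M\<^sub>2 < c\<^sub>2\<close>.

  The total mass comes from \<open>\<Prod>\<^sub>i (1 + x\<^sup>i)\<^bsup>M\<^sub>i(z)\<^esup> = (1 - z x\<^sup>2) / (1 - z x)\<close>, proved by comparing
  logarithmic derivatives. For the limit, \<open>\<Prod>\<^sub>i binom(M\<^sub>i, c\<^sub>i)\<close> has the leading term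
  \<open>z\<^sup>n / \<Prod>\<^sub>i i\<^bsup>c\<^sub>i\<^esup> c\<^sub>i!\<close>, and \<open>|C\<^sub>\<mu>| = n! / \<Prod>\<^sub>i i\<^bsup>c\<^sub>i\<^esup> c\<^sub>i!\<close>.
\<close>

section \<open>Cycle types\<close>

definition partitions :: "nat \<Rightarrow> nat multiset set" where
  "partitions n = {\<mu>. 0 \<notin># \<mu> \<and> \<Sum>\<^sub># \<mu> = n}"

lemma partitions_parts:
  assumes "\<mu> \<in> partitions n"
  shows "set_mset \<mu> \<subseteq> {1..n}"
proof
  fix x assume x: "x \<in># \<mu>"
  then obtain \<nu> where "\<mu> = add_mset x \<nu>" by (metis multi_member_split)
  then have "x \<le> \<Sum>\<^sub># \<mu>" by simp
  with x assms show "x \<in> {1..n}" by (cases "x = 0") (auto simp: partitions_def)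
qed

lemma partitions_0: "partitions 0 = {{#}}"
  using partitions_parts by (fastforce simp: partitions_def)

lemma sum_image_mset_eq_sum_count:
  fixes f :: "'b \<Rightarrow> 'a :: semiring_1"
  assumes "finite A" "set_mset \<mu> \<subseteq> A"
  shows "(\<Sum>x\<in>#\<mu>. f x) = (\<Sum>x\<in>A. of_nat (count \<mu> x) * f x)"
  using assms(2)
proof (induction \<mu>)
  case (add y \<mu>)
  have "(\<Sum>x\<in>A. of_nat (count (add_mset y \<mu>) x) * f x) =
      (\<Sum>x\<in>A. (if x = y then f x else 0) + of_nat (count \<mu> x) * f x)"
    by (intro sum.cong) (auto simp: distrib_right)
  then show ?case using add assms(1) by (simp add: sum.distrib)
qed simp

lemma sum_mult_count_eq_sum_mset: "(\<Sum>i\<in>set_mset \<mu>. i * count \<mu> i) = \<Sum>\<^sub># \<mu>"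
  for \<mu> :: "nat multiset"
  using sum_image_mset_eq_sum_count[of "set_mset \<mu>" \<mu> "\<lambda>i. i"] by (simp add: mult.commute)

lemma partitions_mult_count_le:
  assumes "\<mu> \<in> partitions n"
  shows "i * count \<mu> i \<le> n"
proof (cases "i \<in># \<mu>")
  case True
  then have "i * count \<mu> i \<le> (\<Sum>i\<in>set_mset \<mu>. i * count \<mu> i)" by (intro member_le_sum) auto
  then show ?thesis using assms unfolding sum_mult_count_eq_sum_mset by (simp add: partitions_def)
qed (simp add: not_in_iff)

lemma orbit_eq_if_mem:
  assumes "permutation f" "y \<in> orbit f x"
  shows "orbit f y = orbit f x"
  using assms orbit_cyclic_eq3 cyclic_on_orbit' by metis

lemma orbit_subset_if_closed:
  assumes "x \<in> S" "\<And>y. y \<in> S \<Longrightarrow> f y \<in> S"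
  shows "orbit f x \<subseteq> S"
proof
  fix y assume "y \<in> orbit f x"
  then show "y \<in> S" by induction (auto intro: assms)
qed

lemma sum_card_orbit:
  fixes F :: "nat \<Rightarrow> 'a :: semiring_1"
  assumes "q permutes A" "finite A"
  shows "(\<Sum>x\<in>A. F (card (orbit q x))) = (\<Sum>B\<in>orbit q ` A. of_nat (card B) * F (card B))"
proof -
  have perm: "permutation q" using assms permutation_permutes by blast
  have fibre: "{x \<in> A. orbit q x = B} = B" if "B \<in> orbit q ` A" for B
    using that permutes_orbit_subset[OF assms(1)] permutation_self_in_orbit[OF perm]
      orbit_eq_if_mem[OF perm] by blast
  have "(\<Sum>x\<in>A. F (card (orbit q x))) =
      (\<Sum>B\<in>orbit q ` A. \<Sum>x | x \<in> A \<and> orbit q x = B. F (card (orbit q x)))"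
    using assms(2) by (rule sum.image_gen)
  also have "\<dots> = (\<Sum>B\<in>orbit q ` A. \<Sum>x | x \<in> A \<and> orbit q x = B. F (card B))"
    by (intro sum.cong) auto
  also have "\<dots> = (\<Sum>B\<in>orbit q ` A. of_nat (card B) * F (card B))"
    using fibre by (intro sum.cong) auto
  finally show ?thesis .
qed

lemma finite_Sn: "finite (Sn n)"
  unfolding Sn_def by (simp add: finite_permutations)

lemma sum_card_orbit_eq_sum_cycle_type:
  fixes F :: "nat \<Rightarrow> 'a :: semiring_1"
  assumes "q \<in> Sn n"
  shows "(\<Sum>b = 1..n. F (card (orbit q b))) = (\<Sum>k\<in>#cycle_type n q. of_nat k * F k)"
  using assms sum_card_orbit[of q "{1..n}" F]
  by (simp add: Sn_def cycle_type_def sum_unfold_sum_mset multiset.map_comp comp_def)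

lemma cycle_type_in_partitions:
  assumes "q \<in> Sn n"
  shows "cycle_type n q \<in> partitions n"
proof -
  have q: "q permutes {1..n}" using assms by (simp add: Sn_def)
  have "0 < card (orbit q b)" if "b \<in> {1..n}" for b
    using finite_subset[OF permutes_orbit_subset[OF q that]] orbit_nonempty[of q b]
    by (simp add: card_gt_0_iff)
  then have "0 \<notin># cycle_type n q" by (fastforce simp: cycle_type_def)
  moreover have "\<Sum>\<^sub># (cycle_type n q) = n"
    using sum_card_orbit_eq_sum_cycle_type[OF assms, of "\<lambda>_. 1 :: nat"] by simp
  ultimately show ?thesis by (simp add: partitions_def)
qed

context
  fixes a b :: 'a and q h :: "'a \<Rightarrow> 'a" and S :: "'a set"
  assumes q: "q permutes S" and fin: "finite S" and new_point: "a \<notin> S" and old_point: "b \<in> S"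
  defines "h \<equiv> Transposition.transpose a b \<circ> q"
begin

private lemma permutation_q: "permutation q"
  using q fin permutation_permutes by blast

private lemma permutation_insert_transpose: "permutation h"
  unfolding h_def using permutation_q by (meson permutation_compose permutation_swap_id)

private lemma insert_transpose_apply:
  assumes "y \<in> S"
  shows "h y = (if q y = b then a else q y)"
proof -
  have "q y \<noteq> a" using assms permutes_in_image[OF q, of y] new_point by auto
  then show ?thesis by (simp add: h_def Transposition.transpose_def)
qed

private lemma insert_transpose_apply_new: "h a = b"
  using q new_point by (simp add: h_def permutes_not_in)

lemma orbit_insert_transpose_other:
  assumes "x \<in> S" "b \<notin> orbit q x"
  shows "orbit h x = orbit q x"
proof (rule orbit_cong)
  show "x \<in> orbit q x" using permutation_q by (rule permutation_self_in_orbit)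
  show "h y = q y" if "y \<in> orbit q x" for y
    using orbit.step[OF that] that assms permutes_orbit_subset[OF q assms(1)]
    by (auto simp: insert_transpose_apply)
qed

lemma orbit_insert_transpose_base: "orbit h b = insert a (orbit q b)"
proof
  have sub: "orbit q b \<subseteq> S" using q old_point by (rule permutes_orbit_subset)
  have self: "b \<in> orbit q b" "b \<in> orbit h b"
    using permutation_q permutation_insert_transpose by (auto intro: permutation_self_in_orbit)
  show "orbit h b \<subseteq> insert a (orbit q b)"
  proof (rule orbit_subset_if_closed)
    show "h y \<in> insert a (orbit q b)" if "y \<in> insert a (orbit q b)" for y
      using that sub self(1) orbit.step[of y q b]
      by (auto simp: insert_transpose_apply insert_transpose_apply_new subset_iff)
  qed (use self in simp)
  have "orbit q b \<subseteq> orbit h b \<inter> S"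
  proof (rule orbit_subset_if_closed)
    show "q y \<in> orbit h b \<inter> S" if "y \<in> orbit h b \<inter> S" for y
      using that self(2) old_point permutes_in_image[OF q, of y] orbit.step[of y h b]
      by (auto simp: insert_transpose_apply split: if_splits)
  qed (use self old_point in simp)
  moreover have "a \<in> orbit h b"
    using orbit_eq_if_mem[OF permutation_insert_transpose, of b a] orbit.base[of h a]
      permutation_self_in_orbit[OF permutation_insert_transpose, of a]
    by (simp add: insert_transpose_apply_new)
  ultimately show "insert a (orbit q b) \<subseteq> orbit h b" by blast
qed

lemma orbits_insert_transpose:
  "orbit h ` insert a S = insert (insert a (orbit q b)) (orbit q ` S - {orbit q b})"
proof -
  have base: "orbit h x = insert a (orbit q b)" if "x \<in> insert a (orbit q b)" for x
    using that orbit_insert_transpose_base orbit_eq_if_mem[OF permutation_insert_transpose, of x b]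
    by simp
  have self: "x \<in> orbit q x" for x using permutation_q by (rule permutation_self_in_orbit)
  have "orbit h x = (if orbit q x = orbit q b then insert a (orbit q b) else orbit q x)"
    if "x \<in> S" for x
  proof (cases "b \<in> orbit q x")
    case True
    then have "orbit q b = orbit q x" by (rule orbit_eq_if_mem[OF permutation_q])
    then show ?thesis using self[of x] base[of x] by simp
  next
    case False
    then show ?thesis using orbit_insert_transpose_other[OF that] self[of b] by auto
  qed
  then show ?thesis using base[of a] old_point by (auto simp: image_iff)
qed

end

lemma cycle_type_insert_fixed:
  assumes "q \<in> Sn n"
  shows "cycle_type (Suc n) q = add_mset 1 (cycle_type n q)"
proof -
  have q: "q permutes {1..n}" using assms by (simp add: Sn_def)
  then have "orbit q (Suc n) = {Suc n}"
    by (simp add: orbit_eq_singleton_iff permutes_not_in)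
  moreover have "{Suc n} \<notin> orbit q ` {1..n}"
    using permutes_orbit_subset[OF q] by fastforce
  ultimately show ?thesis
    by (simp add: cycle_type_def atLeastAtMostSuc_conv)
qed

definition lengthen_part :: "nat \<Rightarrow> nat multiset \<Rightarrow> nat multiset" where
  "lengthen_part k \<mu> = add_mset (Suc k) (\<mu> - {#k#})"

lemma cycle_type_insert_transpose:
  assumes "q \<in> Sn n" and b: "b \<in> {1..n}"
  shows "cycle_type (Suc n) (Transposition.transpose (Suc n) b \<circ> q) =
    lengthen_part (card (orbit q b)) (cycle_type n q)"
proof -
  have q: "q permutes {1..n}" using assms(1) by (simp add: Sn_def)
  have sub: "orbit q x \<subseteq> {1..n}" if "x \<in> {1..n}" for x
    using q that by (rule permutes_orbit_subset)
  have "insert (Suc n) (orbit q b) \<notin> orbit q ` {1..n} - {orbit q b}"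
    using sub by fastforce
  moreover have "orbit (Transposition.transpose (Suc n) b \<circ> q) ` {1..Suc n} =
      insert (insert (Suc n) (orbit q b)) (orbit q ` {1..n} - {orbit q b})"
    using orbits_insert_transpose[OF q _ _ b, of "Suc n"] by (simp add: atLeastAtMostSuc_conv)
  moreover have "card (insert (Suc n) (orbit q b)) = Suc (card (orbit q b))"
    using sub[OF b] finite_subset[OF sub[OF b]] by (subst card_insert_disjoint) auto
  moreover have "mset_set (orbit q ` {1..n} - {orbit q b}) =
      mset_set (orbit q ` {1..n}) - {#orbit q b#}"
    using b by (subst mset_set_Diff) auto
  ultimately show ?thesis
    using b by (simp add: lengthen_part_def cycle_type_def image_mset_Diff)
qed

lemma sum_cycle_type_Suc:
  fixes f :: "nat multiset \<Rightarrow> 'a :: semiring_1"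
  shows "(\<Sum>g\<in>Sn (Suc n). f (cycle_type (Suc n) g)) =
    (\<Sum>q\<in>Sn n. f (add_mset 1 (cycle_type n q)) +
      (\<Sum>k\<in>#cycle_type n q. of_nat k * f (lengthen_part k (cycle_type n q))))"
proof -
  have "(\<Sum>g\<in>Sn (Suc n). f (cycle_type (Suc n) g)) = (\<Sum>q\<in>Sn n. f (cycle_type (Suc n) q)) +
      (\<Sum>b = 1..n. \<Sum>q\<in>Sn n. f (cycle_type (Suc n) (Transposition.transpose (Suc n) b \<circ> q)))"
    using sum_over_permutations_insert[of "{1..n}" "Suc n" "\<lambda>g. f (cycle_type (Suc n) g)"]
    by (simp add: Sn_def atLeastAtMostSuc_conv)
  also have "\<dots> = (\<Sum>q\<in>Sn n. f (cycle_type (Suc n) q) +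
      (\<Sum>b = 1..n. f (cycle_type (Suc n) (Transposition.transpose (Suc n) b \<circ> q))))"
    by (subst sum.swap) (simp add: sum.distrib)
  also have "\<dots> = (\<Sum>q\<in>Sn n. f (add_mset 1 (cycle_type n q)) +
      (\<Sum>b = 1..n. f (lengthen_part (card (orbit q b)) (cycle_type n q))))"
    by (intro sum.cong arg_cong2[where f = "(+)"] refl)
      (simp_all add: cycle_type_insert_fixed cycle_type_insert_transpose)
  also have "\<dots> = (\<Sum>q\<in>Sn n. f (add_mset 1 (cycle_type n q)) +
      (\<Sum>k\<in>#cycle_type n q. of_nat k * f (lengthen_part k (cycle_type n q))))"
    using sum_card_orbit_eq_sum_cycle_type[where F = "\<lambda>k. f (lengthen_part k _)"]
    by (intro sum.cong) simp_all
  finally show ?thesis .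
qed

section \<open>Sizes of conjugacy classes\<close>

definition centralizer_size :: "nat multiset \<Rightarrow> nat" where
  "centralizer_size \<mu> = (\<Prod>i\<in>set_mset \<mu>. i ^ count \<mu> i * fact (count \<mu> i))"

lemma centralizer_size_superset:
  assumes "finite A" "set_mset \<mu> \<subseteq> A"
  shows "centralizer_size \<mu> = (\<Prod>i\<in>A. i ^ count \<mu> i * fact (count \<mu> i))"
  unfolding centralizer_size_def
  using assms by (intro prod.mono_neutral_left) (auto simp: not_in_iff)

lemma centralizer_size_add_mset:
  "centralizer_size (add_mset k \<mu>) = k * (count \<mu> k + 1) * centralizer_size \<mu>"
proof -
  let ?A = "insert k (set_mset \<mu>)"
  have "centralizer_size (add_mset k \<mu>) =
      (\<Prod>i\<in>?A. i ^ count (add_mset k \<mu>) i * fact (count (add_mset k \<mu>) i))"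
    by (rule centralizer_size_superset) auto
  also have "\<dots> = (\<Prod>i\<in>?A. (if i = k then k * (count \<mu> k + 1) else 1) *
      (i ^ count \<mu> i * fact (count \<mu> i)))"
    by (intro prod.cong) (auto simp: algebra_simps)
  also have "\<dots> = k * (count \<mu> k + 1) * (\<Prod>i\<in>?A. i ^ count \<mu> i * fact (count \<mu> i))"
    by (simp add: prod.distrib del: prod.insert)
  also have "(\<Prod>i\<in>?A. i ^ count \<mu> i * fact (count \<mu> i)) = centralizer_size \<mu>"
    by (rule centralizer_size_superset[symmetric]) auto
  finally show ?thesis .
qed

definition shorten_part :: "nat \<Rightarrow> nat multiset \<Rightarrow> nat multiset" where
  "shorten_part j \<mu> = (if j = 1 then {#} else {#j - 1#}) + (\<mu> - {#j#})"

text \<open>The number of ways to insert a new point into a permutation of cycle type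
  \<open>shorten_part j \<mu>\<close> so that the cycle type becomes \<open>\<mu>\<close>.\<close>

definition insertion_count :: "nat \<Rightarrow> nat multiset \<Rightarrow> nat" where
  "insertion_count j \<mu> = (if j = 1 then 1 else (j - 1) * (count \<mu> (j - 1) + 1))"

lemma shorten_part_in_partitions:
  assumes "\<mu> \<in> partitions (Suc n)" "j \<in># \<mu>"
  shows "shorten_part j \<mu> \<in> partitions n"
proof -
  obtain \<nu> where "\<mu> = add_mset j \<nu>" using assms(2) by (metis multi_member_split)
  then show ?thesis using assms(1) by (auto simp: partitions_def shorten_part_def)
qed

lemma insertion_count_mult_centralizer_size:
  assumes "j \<in># \<mu>" "j > 0"
  shows "insertion_count j \<mu> * centralizer_size \<mu> =
    j * count \<mu> j * centralizer_size (shorten_part j \<mu>)"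
proof -
  obtain \<nu> where "\<mu> = add_mset j \<nu>" using assms(1) by (metis multi_member_split)
  then show ?thesis using assms(2)
    by (auto simp: shorten_part_def insertion_count_def centralizer_size_add_mset)
qed

lemma mult_count_lengthen_part:
  assumes "k > 0"
  shows "k * count \<nu> k * of_bool (lengthen_part k \<nu> = \<mu>) =
    (if Suc k \<in># \<mu> then insertion_count (Suc k) \<mu> * of_bool (\<nu> = shorten_part (Suc k) \<mu>) else 0)"
proof (cases "k \<in># \<nu>")
  case True
  then obtain \<kappa> where "\<nu> = add_mset k \<kappa>" by (metis multi_member_split)
  then show ?thesis using assms
    by (auto simp: lengthen_part_def shorten_part_def insertion_count_def add_eq_conv_diff
        dest!: multi_member_split)
next
  case False
  then have "\<nu> \<noteq> shorten_part (Suc k) \<mu>" using assms by (auto simp: shorten_part_def)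
  with False show ?thesis by (simp add: not_in_iff)
qed

lemma sum_lengthen_part:
  assumes "\<nu> \<in> partitions n" "\<mu> \<in> partitions (Suc n)"
  shows "of_bool (add_mset 1 \<nu> = \<mu>) + (\<Sum>k\<in>#\<nu>. k * of_bool (lengthen_part k \<nu> = \<mu>)) =
    (\<Sum>j\<in>set_mset \<mu>. insertion_count j \<mu> * of_bool (\<nu> = shorten_part j \<mu>))"
    (is "_ = sum ?w _")
proof -
  have "(\<Sum>k\<in>#\<nu>. k * of_bool (lengthen_part k \<nu> = \<mu>)) =
      (\<Sum>k = 1..n. k * count \<nu> k * of_bool (lengthen_part k \<nu> = \<mu>))"
    using sum_image_mset_eq_sum_count[OF _ partitions_parts[OF assms(1)],
        of "\<lambda>k. k * of_bool (lengthen_part k \<nu> = \<mu>)"]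
    by (simp add: mult_ac)
  also have "\<dots> = (\<Sum>k = 1..n. if Suc k \<in># \<mu> then ?w (Suc k) else 0)"
    by (intro sum.cong refl mult_count_lengthen_part) auto
  also have "\<dots> = (\<Sum>j = Suc 1..Suc n. if j \<in># \<mu> then ?w j else 0)"
    by (rule sum.shift_bounds_cl_Suc_ivl[symmetric])
  finally have cycles: "(\<Sum>k\<in>#\<nu>. k * of_bool (lengthen_part k \<nu> = \<mu>)) = \<dots>" .
  have fixed_point: "of_bool (add_mset 1 \<nu> = \<mu>) = (if 1 \<in># \<mu> then ?w 1 else 0)"
    by (auto simp: shorten_part_def insertion_count_def dest!: multi_member_split)
  have "of_bool (add_mset 1 \<nu> = \<mu>) + (\<Sum>k\<in>#\<nu>. k * of_bool (lengthen_part k \<nu> = \<mu>)) =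
      (\<Sum>j = 1..Suc n. if j \<in># \<mu> then ?w j else 0)"
    unfolding cycles fixed_point by (rule sum.atLeast_Suc_atMost[symmetric]) simp
  also have "\<dots> = sum ?w (set_mset \<mu>)"
    using partitions_parts[OF assms(2)] by (intro sum.mono_neutral_cong_right) auto
  finally show ?thesis .
qed

lemma card_conj_class_eq_sum: "card (conj_class n \<mu>) = (\<Sum>q\<in>Sn n. of_bool (cycle_type n q = \<mu>))"
  using finite_Sn by (simp add: conj_class_def sum_of_bool_eq Int_def)

lemma card_conj_class_Suc:
  assumes "\<mu> \<in> partitions (Suc n)"
  shows "card (conj_class (Suc n) \<mu>) =
    (\<Sum>j\<in>set_mset \<mu>. insertion_count j \<mu> * card (conj_class n (shorten_part j \<mu>)))"
proof -
  have "card (conj_class (Suc n) \<mu>) = (\<Sum>q\<in>Sn n. of_bool (add_mset 1 (cycle_type n q) = \<mu>) +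
      (\<Sum>k\<in>#cycle_type n q. k * of_bool (lengthen_part k (cycle_type n q) = \<mu>)))"
    using sum_cycle_type_Suc[of "\<lambda>\<nu>. of_bool (\<nu> = \<mu>) :: nat"]
    by (simp add: card_conj_class_eq_sum)
  also have "\<dots> = (\<Sum>q\<in>Sn n. \<Sum>j\<in>set_mset \<mu>.
      insertion_count j \<mu> * of_bool (cycle_type n q = shorten_part j \<mu>))"
    by (intro sum.cong refl sum_lengthen_part[OF cycle_type_in_partitions assms])
  also have "\<dots> = (\<Sum>j\<in>set_mset \<mu>. insertion_count j \<mu> * card (conj_class n (shorten_part j \<mu>)))"
    unfolding card_conj_class_eq_sum sum_distrib_left by (rule sum.swap)
  finally show ?thesis .
qed

theorem card_conj_class_mult_centralizer_size:
  assumes "\<mu> \<in> partitions n"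
  shows "card (conj_class n \<mu>) * centralizer_size \<mu> = fact n"
  using assms
proof (induction n arbitrary: \<mu>)
  case 0
  then have "\<mu> = {#}" by (simp add: partitions_0)
  then show ?case by (simp add: conj_class_def Sn_def cycle_type_def centralizer_size_def)
next
  case (Suc n)
  have "card (conj_class (Suc n) \<mu>) * centralizer_size \<mu> =
      (\<Sum>j\<in>set_mset \<mu>. (insertion_count j \<mu> * centralizer_size \<mu>) *
        card (conj_class n (shorten_part j \<mu>)))"
    unfolding card_conj_class_Suc[OF Suc.prems] sum_distrib_right by (simp only: mult_ac)
  also have "\<dots> = (\<Sum>j\<in>set_mset \<mu>. j * count \<mu> j * fact n)"
  proof (rule sum.cong[OF refl])
    fix j assume j: "j \<in># \<mu>"
    with Suc.prems have "j > 0" by (auto simp: partitions_def intro: gr0I)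
    have "(insertion_count j \<mu> * centralizer_size \<mu>) * card (conj_class n (shorten_part j \<mu>)) =
        j * count \<mu> j *
          (card (conj_class n (shorten_part j \<mu>)) * centralizer_size (shorten_part j \<mu>))"
      unfolding insertion_count_mult_centralizer_size[OF j \<open>j > 0\<close>] by (simp only: mult_ac)
    also have "card (conj_class n (shorten_part j \<mu>)) * centralizer_size (shorten_part j \<mu>) =
        fact n"
      using Suc.prems j by (intro Suc.IH shorten_part_in_partitions)
    finally show "(insertion_count j \<mu> * centralizer_size \<mu>) *
        card (conj_class n (shorten_part j \<mu>)) = j * count \<mu> j * fact n" .
  qed
  also have "\<dots> = (\<Sum>j\<in>set_mset \<mu>. j * count \<mu> j) * fact n"
    by (rule sum_distrib_right[symmetric])
  also have "\<dots> = fact (Suc n)"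
    using Suc.prems unfolding sum_mult_count_eq_sum_mset by (simp add: partitions_def)
  finally show ?case .
qed

lemma card_conj_class_pos:
  assumes "\<mu> \<in> partitions n"
  shows "0 < card (conj_class n \<mu>)"
  using card_conj_class_mult_centralizer_size[OF assms] by (auto intro: gr0I)

lemma finite_partitions: "finite (partitions n)"
proof (rule finite_surj[OF finite_Sn[of n]])
  show "partitions n \<subseteq> cycle_type n ` Sn n"
    using card_conj_class_pos by (fastforce simp: conj_class_def card_gt_0_iff)
qed

lemma sum_Sn_average_over_conj_class:
  fixes f :: "nat multiset \<Rightarrow> 'a :: field_char_0"
  shows "(\<Sum>g\<in>Sn n. f (cycle_type n g) / of_nat (card (conj_class n (cycle_type n g)))) =
    (\<Sum>\<mu>\<in>partitions n. f \<mu>)"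
proof -
  have "(\<Sum>g\<in>Sn n. f (cycle_type n g) / of_nat (card (conj_class n (cycle_type n g)))) =
      (\<Sum>\<mu>\<in>partitions n. \<Sum>g | g \<in> Sn n \<and> cycle_type n g = \<mu>.
        f (cycle_type n g) / of_nat (card (conj_class n (cycle_type n g))))"
    using finite_Sn finite_partitions cycle_type_in_partitions
    by (intro sum.group[symmetric]) auto
  also have "\<dots> = (\<Sum>\<mu>\<in>partitions n. \<Sum>g\<in>conj_class n \<mu>. f \<mu> / of_nat (card (conj_class n \<mu>)))"
    by (intro sum.cong) (auto simp: conj_class_def)
  also have "\<dots> = (\<Sum>\<mu>\<in>partitions n. f \<mu>)"
    using card_conj_class_pos by (intro sum.cong) (auto simp: card_gt_0_iff)
  finally show ?thesis .
qed

section \<open>Moebius transforms\<close>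

lemma moebius_mu_1 [simp]: "moebius_mu (Suc 0) = 1"
  using squarefree_1[where ?'a = nat] by (simp add: moebius_mu_def)

lemma moebius_mu_mult_prime:
  assumes "prime p"
  shows "moebius_mu (p * d) = (if p dvd d then 0 else - moebius_mu d)"
proof (cases "p dvd d")
  case True
  then have "p\<^sup>2 dvd p * d" by (auto simp: power2_eq_square)
  then have "\<not> squarefree (p * d)" using assms by (metis not_prime_unit squarefreeD)
  with True show ?thesis by (simp add: moebius_mu_def)
next
  case False
  have squarefree_iff: "squarefree (p * d) \<longleftrightarrow> squarefree d"
    using prime_imp_coprime[OF assms False] assms
    by (auto simp: squarefree_mult_coprime squarefree_prime dest: squarefree_multD)
  have "prime_factors (p * d) = insert p (prime_factors d)"
    using False assms
    by (subst prime_factors_product) (auto simp: prime_factorization_prime intro: gr0I)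
  then have "card (prime_factors (p * d)) = Suc (card (prime_factors d))"
    using False by (simp add: in_prime_factors_iff)
  with False show ?thesis using squarefree_iff by (simp add: moebius_mu_def)
qed

definition moebius_transform :: "(nat \<Rightarrow> 'a) \<Rightarrow> nat \<Rightarrow> 'a :: comm_ring_1" where
  "moebius_transform f n = (\<Sum>d | d dvd n. of_int (moebius_mu d) * f (n div d))"

lemma moebius_transform_1 [simp]: "moebius_transform f (Suc 0) = f 1"
  by (simp add: moebius_transform_def)

lemma moebius_transform_cmult: "moebius_transform (\<lambda>j. c * f j) n = c * moebius_transform f n"
  by (simp add: moebius_transform_def sum_distrib_left mult_ac)

lemma new_divisors_mult_prime:
  fixes p n :: nat
  assumes "prime p"
  shows "{d. d dvd p * n \<and> \<not> d dvd n} = (*) p ` {e. e dvd n \<and> \<not> p * e dvd n}"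
proof (intro equalityI subsetI)
  fix d assume d: "d \<in> {d. d dvd p * n \<and> \<not> d dvd n}"
  then have "\<not> coprime p d" by (auto simp: coprime_commute coprime_dvd_mult_right_iff)
  then obtain e where "d = p * e" using prime_imp_coprime[OF assms] by blast
  with d assms show "d \<in> (*) p ` {e. e dvd n \<and> \<not> p * e dvd n}" by (auto simp: prime_gt_0_nat)
qed auto

lemma moebius_transform_mult_prime:
  assumes p: "prime p" and "n > 0"
  shows "moebius_transform f (p * n) =
    moebius_transform (\<lambda>j. f (p * j)) n - (if p dvd n then 0 else moebius_transform f n)"
proof -
  define g where "g d = of_int (moebius_mu d) * f (p * n div d)" for d
  let ?old = "{d. d dvd n}" and ?new = "{d. d dvd p * n \<and> \<not> d dvd n}"
  have fin: "finite ?old" "finite ?new" using assms by (simp_all add: prime_gt_0_nat)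
  have "moebius_transform f (p * n) = sum g ?old + sum g ?new"
    unfolding moebius_transform_def g_def[symmetric]
    using fin by (subst sum.union_disjoint[symmetric]) (auto intro!: arg_cong2[where f = sum])
  also have "sum g ?old = moebius_transform (\<lambda>j. f (p * j)) n"
    unfolding moebius_transform_def g_def by (intro sum.cong) (auto simp: div_mult_swap)
  also have "sum g ?new = (\<Sum>e | e dvd n \<and> \<not> p * e dvd n. g (p * e))"
    unfolding new_divisors_mult_prime[OF p] using p by (subst sum.reindex) (auto simp: inj_on_def)
  also have "\<dots> = (\<Sum>e | e dvd n. if p dvd n then 0 else - (of_int (moebius_mu e) * f (n div e)))"
  proof (rule sum.mono_neutral_cong_left[OF fin(1)])
    fix e assume e: "e \<in> {e. e dvd n \<and> \<not> p * e dvd n}"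
    have "p dvd e \<longleftrightarrow> p dvd n"
      using e divides_mult[of p n e] prime_imp_coprime[OF p, of e] by (auto intro: dvd_trans)
    then show "g (p * e) = (if p dvd n then 0 else - (of_int (moebius_mu e) * f (n div e)))"
      using p by (simp add: g_def moebius_mu_mult_prime)
  qed (auto dest: dvd_mult_left)
  also have "\<dots> = - (if p dvd n then 0 else moebius_transform f n)"
    by (simp add: moebius_transform_def sum_negf)
  finally show ?thesis by simp
qed

lemma moebius_transform_const:
  assumes "n > 0"
  shows "moebius_transform (\<lambda>_. c) n = (if n = 1 then c else 0)"
  using assms
proof (induction n rule: less_induct)
  case (less n)
  show ?case
  proof (cases "n = 1")
    case False
    then obtain p m where p: "prime p" "n = p * m" using prime_factor_nat by (metis dvdE)
    with less.prems have "m > 0" "m < n" using prime_gt_1_nat[of p] by auto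
    then show ?thesis
      using p less.IH[of m] moebius_transform_mult_prime[of p m "\<lambda>_. c"] by auto
  qed simp
qed

lemma sum_divisors_swap:
  fixes F :: "nat \<Rightarrow> nat \<Rightarrow> 'a :: comm_monoid_add"
  assumes "n > 0"
  shows "(\<Sum>m | m dvd n. \<Sum>d | d dvd m. F d (m div d)) = (\<Sum>j | j dvd n. \<Sum>d | d dvd n div j. F d j)"
proof -
  have fin: "finite {d. d dvd m}" if "m dvd n" for m :: nat
    using that assms by (metis dvd_0_left_iff finite_divisors_nat gr0I)
  have fin_div: "finite {d. d dvd n div j}" if "j dvd n" for j
    using fin[of "n div j"] that by (metis dvd_div_mult_self dvd_triv_left)
  have "(\<Sum>(m, d) \<in> (SIGMA m:{m. m dvd n}. {d. d dvd m}). F d (m div d)) =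
      (\<Sum>(j, d) \<in> (SIGMA j:{j. j dvd n}. {d. d dvd n div j}). F d j)"
  proof (rule sum.reindex_bij_witness[where i = "\<lambda>(j, d). (d * j, d)"
        and j = "\<lambda>(m, d). (m div d, d)"])
    fix x assume "x \<in> (SIGMA m:{m. m dvd n}. {d. d dvd m})"
    then obtain d e k where "x = (d * e, d)" "n = d * e * k" by (auto elim!: dvdE)
    with assms show "(case case x of (m, d) \<Rightarrow> (m div d, d) of (j, d) \<Rightarrow> (d * j, d)) = x"
      "(case x of (m, d) \<Rightarrow> (m div d, d)) \<in> (SIGMA j:{j. j dvd n}. {d. d dvd n div j})"
      by auto
  next
    fix x assume "x \<in> (SIGMA j:{j. j dvd n}. {d. d dvd n div j})"
    then obtain j d k where "x = (j, d)" "n = j * (d * k)"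
      by (auto elim!: dvdE) (metis dvd_mult_div_cancel dvd_triv_left)
    with assms show "(case case x of (j, d) \<Rightarrow> (d * j, d) of (m, d) \<Rightarrow> (m div d, d)) = x"
      "(case x of (j, d) \<Rightarrow> (d * j, d)) \<in> (SIGMA m:{m. m dvd n}. {d. d dvd m})"
      by auto
  qed auto
  then show ?thesis using fin fin_div by (simp add: sum.Sigma assms)
qed

theorem sum_moebius_transform_divisors:
  assumes "n > 0"
  shows "(\<Sum>m | m dvd n. moebius_transform f m) = f n"
proof -
  have "(\<Sum>m | m dvd n. moebius_transform f m) =
      (\<Sum>j | j dvd n. \<Sum>d | d dvd n div j. of_int (moebius_mu d) * f j)"
    unfolding moebius_transform_def using assms by (rule sum_divisors_swap)
  also have "\<dots> = (\<Sum>j | j dvd n. moebius_transform (\<lambda>_. f j) (n div j))"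
    by (simp add: moebius_transform_def)
  also have "\<dots> = (\<Sum>j | j dvd n. if j = n then f n else 0)"
  proof (rule sum.cong[OF refl])
    fix j assume "j \<in> {j. j dvd n}"
    then have "n div j > 0" "n div j = 1 \<longleftrightarrow> j = n" using assms by (auto elim!: dvdE)
    then show "moebius_transform (\<lambda>_. f j) (n div j) = (if j = n then f n else 0)"
      by (simp add: moebius_transform_const)
  qed
  also have "\<dots> = f n" using assms by simp
  finally show ?thesis .
qed

lemma sum_divisors_alternating:
  fixes f :: "nat \<Rightarrow> 'a :: comm_ring_1"
  assumes "n > 0"
  shows "(\<Sum>m | m dvd n. (- 1) ^ (n div m - 1) * f m) =
    (\<Sum>m | m dvd n. f m) - (if even n then 2 * (\<Sum>m | m dvd n div 2. f m) else 0)"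
proof -
  have fin: "finite {m. m dvd n}" using assms by simp
  have even_quotient: "m dvd n \<and> even (n div m) \<longleftrightarrow> even n \<and> m dvd n div 2" for m
  proof (cases "m = 0")
    case False
    then have "even (n div m) \<longleftrightarrow> 2 * m dvd n" if "m dvd n"
      using that by (simp add: dvd_div_iff_mult)
    moreover have "m dvd n div 2 \<longleftrightarrow> 2 * m dvd n" if "even n"
      using that by (simp add: dvd_div_iff_mult mult.commute)
    ultimately show ?thesis by (meson dvd_mult_left dvd_mult_right)
  qed (use assms in \<open>auto elim!: evenE\<close>)
  have "(\<Sum>m | m dvd n. (- 1) ^ (n div m - 1) * f m) =
      (\<Sum>m | m dvd n. f m - (if even (n div m) then 2 * f m else 0))"
  proof (rule sum.cong[OF refl])
    fix m assume "m \<in> {m. m dvd n}"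
    then have "n div m > 0" using assms by (auto elim!: dvdE)
    then show "(- 1) ^ (n div m - 1) * f m = f m - (if even (n div m) then 2 * f m else 0)"
      by (cases "n div m") auto
  qed
  also have "\<dots> = (\<Sum>m | m dvd n. f m) - 2 * (\<Sum>m | m dvd n \<and> even (n div m). f m)"
    using fin by (simp add: sum_subtractf sum.If_cases sum_distrib_left Int_def)
  also have "\<dots> = (\<Sum>m | m dvd n. f m) - (if even n then 2 * (\<Sum>m | m dvd n div 2. f m) else 0)"
    unfolding even_quotient by simp
  finally show ?thesis .
qed

section \<open>Necklace polynomials\<close>

text \<open>For a positive integer \<open>z\<close> this counts the aperiodic words of length \<open>m\<close> over \<open>z\<close> letters.\<close>

definition primitive_words :: "nat \<Rightarrow> 'a \<Rightarrow> 'a :: comm_ring_1" where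
  "primitive_words m z = moebius_transform (\<lambda>j. z ^ j) m"

definition necklace_poly :: "nat \<Rightarrow> 'a \<Rightarrow> 'a :: field_char_0" where
  "necklace_poly m z = primitive_words m z / of_nat m"

lemma primitive_words_1 [simp]: "primitive_words (Suc 0) z = z"
  by (simp add: primitive_words_def)

lemma primitive_words_uminus_odd:
  assumes "odd m"
  shows "primitive_words m (- z) = - primitive_words m z"
proof -
  have "odd (m div d)" if "d dvd m" for d
    using assms that by (metis dvd_mult_div_cancel even_mult_iff)
  then show ?thesis
    by (simp add: primitive_words_def moebius_transform_def flip: sum_negf)
qed

lemma primitive_words_double:
  assumes "m > 0"
  shows "primitive_words (2 * m) z =
    primitive_words m (z\<^sup>2) - (if even m then 0 else primitive_words m z)"
  using moebius_transform_mult_prime[of 2 m "\<lambda>j. z ^ j"] assms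
  by (simp add: primitive_words_def flip: power_mult)

lemma primitive_words_2: "primitive_words 2 z = z\<^sup>2 - z"
  using primitive_words_double[of 1 z] by simp

lemma primitive_words_uminus_double:
  assumes "m > 0"
  shows "primitive_words (2 * m) (- z) =
    primitive_words m (z\<^sup>2) + (if even m then 0 else primitive_words m z)"
  using assms by (simp add: primitive_words_double primitive_words_uminus_odd)

definition jordan_totient :: "nat \<Rightarrow> nat \<Rightarrow> int" where
  "jordan_totient k n = moebius_transform (\<lambda>j. int j ^ k) n"

lemma jordan_totient_1 [simp]: "jordan_totient k (Suc 0) = 1"
  by (simp add: jordan_totient_def)

lemma jordan_totient_mult_prime:
  assumes "prime p" "n > 0"
  shows "jordan_totient k (p * n) = (int p ^ k - (if p dvd n then 0 else 1)) * jordan_totient k n"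
  using moebius_transform_mult_prime[OF assms, of "\<lambda>j. int j ^ k"]
  by (simp add: jordan_totient_def power_mult_distrib moebius_transform_cmult left_diff_distrib)

lemma jordan_totient_0:
  assumes "n \<ge> 2"
  shows "jordan_totient 0 n = 0"
  using assms by (simp add: jordan_totient_def moebius_transform_const)

lemma jordan_totient_pos:
  assumes "n > 0" "k > 0"
  shows "0 < jordan_totient k n"
  using assms(1)
proof (induction n rule: prime_divisors_induct)
  case (factor p n)
  then have "1 < int p ^ k" using assms(2) by (intro one_less_power) (auto dest: prime_gt_1_nat)
  with factor show ?case by (simp add: jordan_totient_mult_prime)
qed auto

lemma jordan_totient_2_le:
  assumes "n \<ge> 2"
  shows "jordan_totient k 2 \<le> jordan_totient k n"
proof (cases "k = 0")
  case False
  obtain p m where p: "prime p" "n = p * m" using assms prime_factor_nat[of n] by (auto elim!: dvdE)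
  with assms have "m > 0" by (auto intro: gr0I)
  have "jordan_totient k 2 = 2 ^ k - 1"
    using jordan_totient_mult_prime[of 2 1 k] by simp
  also have "\<dots> \<le> int p ^ k - (if p dvd m then 0 else 1)"
    using power_mono[of 2 "int p" k] prime_ge_2_nat[OF p(1)] by simp
  also have "\<dots> * 1 \<le> \<dots> * jordan_totient k m"
    using jordan_totient_pos[OF \<open>m > 0\<close>, of k] False prime_gt_0_nat[OF p(1)]
    by (intro mult_left_mono) (auto simp: one_le_power)
  also have "\<dots> = jordan_totient k n"
    using p \<open>m > 0\<close> by (simp add: jordan_totient_mult_prime)
  finally show ?thesis by simp
qed (use assms in \<open>simp add: jordan_totient_0\<close>)

lemma primitive_words_exp_sums:
  "(\<lambda>k. real_of_int (jordan_totient k n) * (y ^ k /\<^sub>R fact k)) sums primitive_words n (exp y)"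
proof -
  have "(\<lambda>k. \<Sum>d | d dvd n. real_of_int (moebius_mu d) * ((real (n div d) * y) ^ k /\<^sub>R fact k)) sums
      (\<Sum>d | d dvd n. real_of_int (moebius_mu d) * exp (real (n div d) * y))"
    by (intro sums_sum sums_mult exp_converges)
  then show ?thesis
    unfolding exp_of_nat_mult
    by (simp add: primitive_words_def jordan_totient_def moebius_transform_def power_mult_distrib
        sum_distrib_left mult_ac)
qed

lemma primitive_words_2_le:
  fixes x :: real
  assumes "n \<ge> 2" "x \<ge> 1"
  shows "primitive_words 2 x \<le> primitive_words n x"
proof -
  have "primitive_words 2 (exp (ln x)) \<le> primitive_words n (exp (ln x))"
  proof (rule sums_le[OF _ primitive_words_exp_sums primitive_words_exp_sums])
    show "real_of_int (jordan_totient k 2) * (ln x ^ k /\<^sub>R fact k)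
        \<le> real_of_int (jordan_totient k n) * (ln x ^ k /\<^sub>R fact k)" for k
      using assms jordan_totient_2_le[of n k] by (intro mult_right_mono) auto
  qed
  then show ?thesis using assms(2) by simp
qed

lemma primitive_words_pos:
  fixes x :: real
  assumes "n > 0" "x > 1"
  shows "0 < primitive_words n x"
proof (cases "n = 1")
  case False
  have "x < x\<^sup>2" using assms(2) by (simp add: power2_eq_square)
  then show ?thesis
    using False assms primitive_words_2_le[of n x] by (simp add: primitive_words_2)
qed (use assms in simp)

lemma primitive_words_nonneg:
  fixes x :: real
  assumes "n > 0" "x \<ge> 1"
  shows "0 \<le> primitive_words n x"
  using assms primitive_words_pos[of n x]
  by (cases "x = 1") (auto simp: primitive_words_def moebius_transform_const)

lemma sum_primitive_words_alternating:
  assumes "n > 0"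
  shows "(\<Sum>m | m dvd n. (- 1) ^ (n div m - 1) * primitive_words m z) =
    z ^ n - (if even n then 2 * z ^ (n div 2) else 0)"
  using assms sum_divisors_alternating[OF assms, of "\<lambda>m. primitive_words m z"]
  by (auto simp: primitive_words_def sum_moebius_transform_divisors elim!: evenE)

section \<open>The generating function of squarefree factorization types\<close>

definition partitions_into :: "nat set \<Rightarrow> nat \<Rightarrow> nat multiset set" where
  "partitions_into I m = {\<mu>. set_mset \<mu> \<subseteq> I \<and> \<Sum>\<^sub># \<mu> = m}"

lemma partitions_eq_partitions_into: "partitions n = partitions_into {1..n} n"
proof
  show "partitions n \<subseteq> partitions_into {1..n} n"
    using partitions_parts by (auto simp: partitions_def partitions_into_def)
qed (auto simp: partitions_def partitions_into_def)

lemma partitions_into_empty: "partitions_into {} m = (if m = 0 then {{#}} else {})"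
  by (auto simp: partitions_into_def)

lemma partitions_into_0:
  assumes "0 \<notin> I"
  shows "partitions_into I 0 = {{#}}"
proof -
  have "\<mu> = {#}" if "\<mu> \<in> partitions_into I 0" for \<mu>
    using that assms by (cases \<mu>) (auto simp: partitions_into_def)
  then show ?thesis by (auto simp: partitions_into_def)
qed

lemma finite_multiples_le:
  assumes "i > 0"
  shows "finite {c :: nat. i * c \<le> m}"
proof (rule finite_subset)
  show "{c. i * c \<le> m} \<subseteq> {..m}"
    using assms by (cases i) auto
qed simp

lemma bij_betw_partitions_into_insert:
  assumes "i \<notin> I"
  shows "bij_betw (\<lambda>(c, \<mu>). \<mu> + replicate_mset c i)
    (SIGMA c:{c. i * c \<le> m}. partitions_into I (m - i * c)) (partitions_into (insert i I) m)"
proof (rule bij_betw_imageI)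
  have count_0: "count \<mu> i = 0" if "\<mu> \<in> partitions_into I k" for \<mu> k
    using that assms by (auto simp: partitions_into_def count_eq_zero_iff)
  show "inj_on (\<lambda>(c, \<mu>). \<mu> + replicate_mset c i)
      (SIGMA c:{c. i * c \<le> m}. partitions_into I (m - i * c))"
  proof (rule inj_onI, clarify)
    fix c \<mu> d \<nu>
    assume mem: "\<mu> \<in> partitions_into I (m - i * c)" "\<nu> \<in> partitions_into I (m - i * d)"
      and eq: "\<mu> + replicate_mset c i = \<nu> + replicate_mset d i"
    then have "count (\<mu> + replicate_mset c i) i = count (\<nu> + replicate_mset d i) i" by simp
    then have "c = d" using mem by (simp add: count_0)
    with eq show "c = d \<and> \<mu> = \<nu>" by simp
  qed
  show "(\<lambda>(c, \<mu>). \<mu> + replicate_mset c i) `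
      (SIGMA c:{c. i * c \<le> m}. partitions_into I (m - i * c)) = partitions_into (insert i I) m"
  proof (intro equalityI subsetI)
    fix \<mu> assume \<mu>: "\<mu> \<in> partitions_into (insert i I) m"
    let ?\<nu> = "filter_mset (\<lambda>j. j \<noteq> i) \<mu>" and ?c = "count \<mu> i"
    have split: "\<mu> = ?\<nu> + replicate_mset ?c i" by (rule multiset_eqI) auto
    have "m = \<Sum>\<^sub># ?\<nu> + i * ?c"
      using \<mu> arg_cong[OF split, of sum_mset]
      by (simp add: partitions_into_def sum_mset_replicate_mset mult.commute)
    then have "(?c, ?\<nu>) \<in> (SIGMA c:{c. i * c \<le> m}. partitions_into I (m - i * c))"
      using \<mu> by (auto simp: partitions_into_def)
    then show "\<mu> \<in> (\<lambda>(c, \<mu>). \<mu> + replicate_mset c i) `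
        (SIGMA c:{c. i * c \<le> m}. partitions_into I (m - i * c))"
      using split by (intro image_eqI[where x = "(?c, ?\<nu>)"]) auto
  qed (fastforce simp: partitions_into_def sum_mset_replicate_mset mult.commute split: if_splits)
qed

lemma finite_partitions_into:
  assumes "finite I" "0 \<notin> I"
  shows "finite (partitions_into I m)"
  using assms
proof (induction I arbitrary: m rule: finite_induct)
  case empty
  then show ?case by (simp add: partitions_into_empty)
next
  case (insert i I)
  then have "finite (SIGMA c:{c. i * c \<le> m}. partitions_into I (m - i * c))"
    using finite_multiples_le[of i m] by (intro finite_SigmaI) auto
  then show ?case using bij_betw_finite[OF bij_betw_partitions_into_insert] insert.hyps by blast
qed

lemma fps_nth_compose_X_power_mult:
  fixes f F :: "'a :: comm_ring_1 fps"
  assumes "i > 0"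
  shows "((f oo fps_X ^ i) * F) $ m = (\<Sum>c | i * c \<le> m. f $ c * F $ (m - i * c))"
proof -
  have "((f oo fps_X ^ i) * F) $ m =
      (\<Sum>j = 0..m. (if i dvd j then f $ (j div i) else 0) * F $ (m - j))"
    by (simp add: fps_mult_nth fps_nth_compose_X_power)
  also have "\<dots> = (\<Sum>j \<in> (*) i ` {c. i * c \<le> m}. f $ (j div i) * F $ (m - j))"
    by (rule sum.mono_neutral_cong_right) (auto elim!: dvdE)
  also have "\<dots> = (\<Sum>c | i * c \<le> m. f $ c * F $ (m - i * c))"
    using assms by (subst sum.reindex) (auto simp: inj_on_def)
  finally show ?thesis .
qed

lemma fps_nth_prod_compose_X_power:
  fixes f :: "nat \<Rightarrow> 'a :: comm_ring_1 fps"
  assumes "finite I" "0 \<notin> I"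
  shows "(\<Prod>i\<in>I. f i oo fps_X ^ i) $ m = (\<Sum>\<mu>\<in>partitions_into I m. \<Prod>i\<in>I. f i $ count \<mu> i)"
  using assms
proof (induction I arbitrary: m rule: finite_induct)
  case empty
  then show ?case by (simp add: partitions_into_empty)
next
  case (insert i I)
  let ?P = "\<lambda>c. partitions_into I (m - i * c)"
  have i: "i > 0" "0 \<notin> I" using insert.prems by auto
  have "(\<Prod>j\<in>insert i I. f j oo fps_X ^ j) $ m =
      (\<Sum>c | i * c \<le> m. f i $ c * (\<Prod>j\<in>I. f j oo fps_X ^ j) $ (m - i * c))"
    using insert.hyps i by (simp add: fps_nth_compose_X_power_mult)
  also have "\<dots> = (\<Sum>c | i * c \<le> m. \<Sum>\<mu>\<in>?P c. f i $ c * (\<Prod>j\<in>I. f j $ count \<mu> j))"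
    by (simp only: insert.IH[OF i(2)] sum_distrib_left)
  also have "\<dots> = (\<Sum>(c, \<mu>)\<in>(SIGMA c:{c. i * c \<le> m}. ?P c). f i $ c * (\<Prod>j\<in>I. f j $ count \<mu> j))"
    using finite_multiples_le[OF i(1)] finite_partitions_into[OF insert.hyps(1) i(2)]
    by (subst sum.Sigma) auto
  also have "\<dots> = (\<Sum>(c, \<mu>)\<in>(SIGMA c:{c. i * c \<le> m}. ?P c).
      \<Prod>j\<in>insert i I. f j $ count (\<mu> + replicate_mset c i) j)"
  proof (intro sum.cong refl, clarify)
    fix c \<mu> assume "\<mu> \<in> ?P c"
    then have "count \<mu> i = 0"
      using insert.hyps(2) by (auto simp: partitions_into_def count_eq_zero_iff)
    moreover have "(\<Prod>j\<in>I. f j $ count (\<mu> + replicate_mset c i) j) = (\<Prod>j\<in>I. f j $ count \<mu> j)"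
      using insert.hyps(2) by (intro prod.cong) auto
    ultimately show "f i $ c * (\<Prod>j\<in>I. f j $ count \<mu> j) =
        (\<Prod>j\<in>insert i I. f j $ count (\<mu> + replicate_mset c i) j)"
      using insert.hyps by simp
  qed
  also have "\<dots> = (\<Sum>\<mu>\<in>partitions_into (insert i I) m. \<Prod>j\<in>insert i I. f j $ count \<mu> j)"
    by (subst sum.reindex_bij_betw[symmetric,
          OF bij_betw_partitions_into_insert[OF insert.hyps(2)]])
      (simp add: case_prod_unfold)
  finally show ?case .
qed

text \<open>\<open>G\<close> is the Euler logarithmic derivative \<open>X F' / F\<close>.\<close>

definition fps_has_log_deriv :: "'a :: comm_ring_1 fps \<Rightarrow> 'a fps \<Rightarrow> bool" where
  "fps_has_log_deriv F G \<longleftrightarrow> fps_X * fps_deriv F = F * G"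

lemma fps_has_log_deriv_mult:
  assumes "fps_has_log_deriv F G" "fps_has_log_deriv H K"
  shows "fps_has_log_deriv (F * H) (G + K)"
proof -
  have "fps_X * fps_deriv (F * H) = (fps_X * fps_deriv F) * H + F * (fps_X * fps_deriv H)"
    by (simp add: algebra_simps)
  also have "\<dots> = F * G * H + F * (H * K)"
    using assms by (simp only: fps_has_log_deriv_def)
  finally show ?thesis by (simp add: fps_has_log_deriv_def algebra_simps)
qed

lemma fps_has_log_deriv_prod:
  assumes "\<And>i. i \<in> I \<Longrightarrow> fps_has_log_deriv (f i) (g i)"
  shows "fps_has_log_deriv (prod f I) (sum g I)"
  using assms
proof (induction I rule: infinite_finite_induct)
  case (insert i I)
  then show ?case by (simp add: fps_has_log_deriv_mult)
qed (simp_all add: fps_has_log_deriv_def)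

lemma fps_has_log_deriv_inverse:
  assumes "fps_has_log_deriv F G" "F * H = 1"
  shows "fps_has_log_deriv H (- G)"
proof -
  have "F * fps_deriv H = - (fps_deriv F * H)"
    using arg_cong[OF assms(2), of fps_deriv] by (simp add: add_eq_0_iff)
  then have "F * (fps_X * fps_deriv H) = - (fps_X * fps_deriv F * H)"
    by (simp add: mult.left_commute[of F] mult.assoc)
  also have "\<dots> = F * (H * - G)"
    using assms(1) unfolding fps_has_log_deriv_def by (simp only: mult_minus_right mult_ac)
  finally have "F * (fps_X * fps_deriv H) = F * (H * - G)" .
  then have "H * F * (fps_X * fps_deriv H) = H * F * (H * - G)" by (simp only: mult.assoc)
  then show ?thesis using assms(2) by (simp add: fps_has_log_deriv_def mult.commute)
qed

lemma fps_has_log_deriv_compose_X_power: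
  fixes F :: "'a :: idom fps"
  assumes "fps_has_log_deriv F G" "i > 0"
  shows "fps_has_log_deriv (F oo fps_X ^ i) (of_nat i * (G oo fps_X ^ i))"
proof -
  have X_power_0: "(fps_X ^ i :: 'a fps) $ 0 = 0" using assms(2) by simp
  have "fps_X * fps_deriv (fps_X ^ i :: 'a fps) = of_nat i * fps_X ^ i"
    using assms(2)
    by (simp add: fps_deriv_power fps_of_nat mult.left_commute[of fps_X] flip: power_Suc)
  then have "fps_X * fps_deriv (F oo fps_X ^ i) =
      of_nat i * ((fps_deriv F oo fps_X ^ i) * fps_X ^ i)"
    by (simp add: fps_compose_deriv[OF X_power_0] mult.left_commute)
  also have "(fps_deriv F oo fps_X ^ i) * fps_X ^ i = (fps_X * fps_deriv F) oo fps_X ^ i"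
    using X_power_0 by (simp add: fps_compose_mult_distrib mult.commute)
  also have "\<dots> = (F oo fps_X ^ i) * (G oo fps_X ^ i)"
    using assms(1) X_power_0 by (simp add: fps_has_log_deriv_def fps_compose_mult_distrib)
  finally show ?thesis by (simp add: fps_has_log_deriv_def mult.left_commute)
qed

lemma fps_has_log_deriv_binomial:
  fixes c :: "'a :: field_char_0"
  shows "fps_has_log_deriv (fps_binomial c)
    (fps_const c * Abs_fps (\<lambda>k. if k = 0 then 0 else (- 1) ^ (k - 1)))"
    (is "fps_has_log_deriv _ (_ * ?A)")
proof -
  have series: "(1 + fps_X) * ?A = fps_X"
  proof (rule fps_ext)
    fix k show "((1 + fps_X) * ?A) $ k = fps_X $ k"
      by (cases k; cases "k - 1") (auto simp: distrib_right)
  qed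
  have "(1 + fps_X :: 'a fps) $ 0 \<noteq> 0" by simp
  then have ode: "(1 + fps_X) * fps_deriv (fps_binomial c) = fps_const c * fps_binomial c"
    by (simp add: fps_binomial_deriv fps_divide_unit inverse_mult_eq_1' mult.left_commute)
  have "fps_X * fps_deriv (fps_binomial c) = (1 + fps_X) * ?A * fps_deriv (fps_binomial c)"
    by (simp only: series)
  also have "\<dots> = (1 + fps_X) * fps_deriv (fps_binomial c) * ?A"
    by (simp only: mult_ac)
  also have "\<dots> = fps_binomial c * (fps_const c * ?A)"
    unfolding ode by (simp only: mult_ac)
  finally show ?thesis by (simp only: fps_has_log_deriv_def)
qed

lemma one_minus_X_mult_geometric: "(1 - fps_const z * fps_X) * Abs_fps (\<lambda>k. z ^ k) = 1"
  for z :: "'a :: comm_ring_1"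
proof (rule fps_ext)
  fix k show "((1 - fps_const z * fps_X) * Abs_fps (\<lambda>k. z ^ k)) $ k = 1 $ k"
    by (cases k) (auto simp: left_diff_distrib mult.assoc)
qed

lemma fps_has_log_deriv_one_minus_X:
  fixes z :: "'a :: comm_ring_1"
  shows "fps_has_log_deriv (1 - fps_const z * fps_X) (1 - Abs_fps (\<lambda>k. z ^ k))"
proof -
  have "fps_X * fps_deriv (1 - fps_const z * fps_X) = - (fps_const z * fps_X)"
    by (simp add: mult.commute flip: fps_const_neg)
  then show ?thesis
    by (simp add: fps_has_log_deriv_def right_diff_distrib one_minus_X_mult_geometric)
qed

lemma fps_log_deriv_unique:
  fixes F H :: "'a :: field_char_0 fps"
  assumes "fps_has_log_deriv F G" "fps_has_log_deriv H K" "F $ 0 = H $ 0"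
    and G_0: "G $ 0 = 0" and G_eq_K: "\<And>k. k \<le> n \<Longrightarrow> G $ k = K $ k"
  shows "k \<le> n \<Longrightarrow> F $ k = H $ k"
proof (induction k rule: less_induct)
  case (less k)
  have recurrence: "of_nat k * P $ k = (\<Sum>j<k. P $ j * Q $ (k - j))"
    if "fps_has_log_deriv P Q" "Q $ 0 = 0" for P Q :: "'a fps"
  proof -
    have "of_nat k * P $ k = (fps_X * fps_deriv P) $ k" by (cases k) auto
    also have "\<dots> = (\<Sum>j<Suc k. P $ j * Q $ (k - j))"
      using that(1)
      by (simp only: fps_has_log_deriv_def fps_mult_nth lessThan_Suc_atMost atMost_atLeast0)
    finally show ?thesis using that(2) by simp
  qed
  have "(\<Sum>j<k. F $ j * G $ (k - j)) = (\<Sum>j<k. H $ j * K $ (k - j))"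
    using less G_eq_K by (intro sum.cong) auto
  then have "of_nat k * F $ k = of_nat k * H $ k"
    using recurrence[OF assms(1) G_0] recurrence[OF assms(2)] G_eq_K[of 0] G_0 by simp
  then show ?case using assms(3) by (cases "k = 0") auto
qed

text \<open>For a prime power \<open>z\<close>, the coefficient of \<open>X\<^sup>k\<close> is the number of monic squarefree polynomials
  of degree \<open>k\<close> over the field with \<open>z\<close> elements.\<close>

definition squarefree_series :: "'a \<Rightarrow> 'a :: comm_ring_1 fps" where
  "squarefree_series z = ((1 - fps_const z * fps_X) oo fps_X\<^sup>2) * Abs_fps (\<lambda>k. z ^ k)"

lemma squarefree_series_nth:
  fixes z :: "'a :: comm_ring_1"
  shows "squarefree_series z $ k = (if k < 2 then z ^ k else z ^ k - z ^ (k - 1))"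
proof -
  have "(1 - fps_const z * fps_X) oo fps_X\<^sup>2 = 1 - fps_const z * fps_X\<^sup>2"
    by (rule fps_ext) (auto simp: fps_nth_compose_X_power elim!: evenE)
  then have "squarefree_series z $ k =
      (Abs_fps (\<lambda>k. z ^ k) - fps_const z * (fps_X\<^sup>2 * Abs_fps (\<lambda>k. z ^ k))) $ k"
    by (simp add: squarefree_series_def left_diff_distrib mult.assoc)
  also have "\<dots> = (if k < 2 then z ^ k else z ^ k - z ^ (k - 1))"
    by (auto simp: fps_X_power_mult_nth Suc_diff_Suc numeral_2_eq_2 simp flip: power_Suc)
  finally show ?thesis .
qed

definition squarefree_log_deriv :: "'a \<Rightarrow> 'a :: comm_ring_1 fps" where
  "squarefree_log_deriv z =
    Abs_fps (\<lambda>k. if k = 0 then 0 else z ^ k - (if even k then 2 * z ^ (k div 2) else 0))"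

lemma fps_has_log_deriv_squarefree_series:
  fixes z :: "'a :: idom"
  shows "fps_has_log_deriv (squarefree_series z) (squarefree_log_deriv z)"
proof -
  let ?L = "1 - Abs_fps (\<lambda>k. z ^ k)"
  have "fps_has_log_deriv (squarefree_series z) (of_nat 2 * (?L oo fps_X\<^sup>2) + - ?L)"
    unfolding squarefree_series_def
    by (intro fps_has_log_deriv_mult fps_has_log_deriv_compose_X_power fps_has_log_deriv_one_minus_X
        fps_has_log_deriv_inverse[OF _ one_minus_X_mult_geometric]) simp
  also have "of_nat 2 * (?L oo fps_X\<^sup>2) + - ?L = squarefree_log_deriv z"
    by (rule fps_ext)
      (auto simp: squarefree_log_deriv_def fps_nth_compose_X_power numeral_fps_const elim!: evenE)
  finally show ?thesis .
qed

text \<open>For a prime power \<open>z\<close>, the number of monic squarefree polynomials over the field with \<open>z\<close>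
  elements whose irreducible factors have the degrees \<open>\<mu>\<close>.\<close>

definition squarefree_count :: "'a \<Rightarrow> nat multiset \<Rightarrow> 'a :: field_char_0" where
  "squarefree_count z \<mu> = (\<Prod>i\<in>set_mset \<mu>. necklace_poly i z gchoose count \<mu> i)"

lemma squarefree_count_superset:
  assumes "finite A" "set_mset \<mu> \<subseteq> A"
  shows "squarefree_count z \<mu> = (\<Prod>i\<in>A. necklace_poly i z gchoose count \<mu> i)"
  unfolding squarefree_count_def
  using assms by (intro prod.mono_neutral_left) (auto simp: not_in_iff)

definition necklace_log_deriv :: "nat \<Rightarrow> 'a \<Rightarrow> 'a :: comm_ring_1 fps" where
  "necklace_log_deriv i z =
    Abs_fps (\<lambda>k. if k > 0 \<and> i dvd k then (- 1) ^ (k div i - 1) * primitive_words i z else 0)"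

lemma fps_has_log_deriv_necklace_factor:
  fixes z :: "'a :: field_char_0"
  assumes "i > 0"
  shows "fps_has_log_deriv (fps_binomial (necklace_poly i z) oo fps_X ^ i)
    (necklace_log_deriv i z)"
proof -
  let ?A = "Abs_fps (\<lambda>k. if k = 0 then 0 else (- 1) ^ (k - 1)) :: 'a fps"
  have "fps_has_log_deriv (fps_binomial (necklace_poly i z) oo fps_X ^ i)
      (of_nat i * ((fps_const (necklace_poly i z) * ?A) oo fps_X ^ i))"
    by (intro fps_has_log_deriv_compose_X_power fps_has_log_deriv_binomial assms)
  also have "of_nat i * ((fps_const (necklace_poly i z) * ?A) oo fps_X ^ i) =
      necklace_log_deriv i z"
    using assms by (intro fps_ext)
      (auto simp: necklace_log_deriv_def necklace_poly_def fps_nth_compose_X_power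
        simp flip: fps_of_nat elim!: dvdE)
  finally show ?thesis .
qed

theorem sum_squarefree_count:
  fixes z :: "'a :: field_char_0"
  shows "(\<Sum>\<mu>\<in>partitions n. squarefree_count z \<mu>) = squarefree_series z $ n"
proof -
  let ?F = "\<Prod>i = 1..n. fps_binomial (necklace_poly i z) oo fps_X ^ i"
  let ?G = "\<lambda>i. necklace_log_deriv i z"
  have "(\<Sum>\<mu>\<in>partitions n. squarefree_count z \<mu>) = ?F $ n"
    unfolding partitions_eq_partitions_into
    by (simp add: fps_nth_prod_compose_X_power)
      (auto intro!: sum.cong squarefree_count_superset simp: partitions_into_def)
  also have "\<dots> = squarefree_series z $ n"
  proof (rule fps_log_deriv_unique)
    show "fps_has_log_deriv ?F (\<Sum>i = 1..n. ?G i)"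
      by (intro fps_has_log_deriv_prod fps_has_log_deriv_necklace_factor) simp
    show "?F $ 0 = squarefree_series z $ 0"
      by (simp add: fps_nth_prod_compose_X_power partitions_into_0 squarefree_series_nth)
    show G_0: "(\<Sum>i = 1..n. ?G i) $ 0 = 0" by (simp add: necklace_log_deriv_def fps_sum_nth)
    show "(\<Sum>i = 1..n. ?G i) $ k = squarefree_log_deriv z $ k" if "k \<le> n" for k
    proof (cases "k = 0")
      case False
      have "(\<Sum>i = 1..n. ?G i) $ k = (\<Sum>i | i dvd k. (- 1) ^ (k div i - 1) * primitive_words i z)"
        unfolding fps_sum_nth necklace_log_deriv_def
        by (intro sum.mono_neutral_cong_right)
          (use False that in \<open>auto simp: dvd_pos_nat Suc_le_eq intro: order.trans[OF dvd_imp_le]\<close>)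
      then show ?thesis
        using False sum_primitive_words_alternating[of k z] by (simp add: squarefree_log_deriv_def)
    qed (use G_0 in \<open>simp add: squarefree_log_deriv_def\<close>)
  qed (rule fps_has_log_deriv_squarefree_series order_refl)+
  finally show ?thesis .
qed

lemma squarefree_count_singleton: "squarefree_count z {#m#} = necklace_poly m z"
  by (simp add: squarefree_count_def)

lemma partitions_part_lt:
  assumes "\<mu> \<in> partitions m - {{#m#}}" "i \<in># \<mu>"
  shows "0 < i" "i < m"
proof -
  obtain \<nu> where \<nu>: "\<mu> = add_mset i \<nu>" using assms(2) by (metis multi_member_split)
  have "i \<noteq> m"
  proof
    assume "i = m"
    then have "\<nu> \<in> partitions 0" using assms(1) \<nu> by (auto simp: partitions_def)
    with assms(1) \<nu> \<open>i = m\<close> show False by (simp add: partitions_0)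
  qed
  then show "0 < i" "i < m" using partitions_parts[of \<mu> m] assms by auto
qed

lemma gchoose_Ints:
  fixes a :: "'a :: field_char_0"
  assumes "a \<in> \<int>"
  shows "a gchoose c \<in> \<int>"
  using assms by (elim Ints_cases) (simp flip: of_int_gbinomial)

text \<open>The partition \<open>\<langle>m\<rangle>\<close> contributes \<open>M\<^sub>m(a)\<close> to the sum over all partitions of \<open>m\<close>; the other terms
  only involve \<open>M\<^sub>i(a)\<close> with \<open>i < m\<close>.\<close>

theorem necklace_poly_Ints:
  fixes a :: "'a :: field_char_0"
  assumes "a \<in> \<int>" "m > 0"
  shows "necklace_poly m a \<in> \<int>"
  using assms(2)
proof (induction m rule: less_induct)
  case (less m)
  have "{#m#} \<in> partitions m" using less.prems by (simp add: partitions_def)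
  then have "necklace_poly m a =
      squarefree_series a $ m - (\<Sum>\<mu>\<in>partitions m - {{#m#}}. squarefree_count a \<mu>)"
    by (simp add: sum.remove[OF finite_partitions] squarefree_count_singleton
        flip: sum_squarefree_count)
  moreover have "squarefree_count a \<mu> \<in> \<int>" if "\<mu> \<in> partitions m - {{#m#}}" for \<mu>
    unfolding squarefree_count_def
    using partitions_part_lt[OF that] by (intro Ints_prod gchoose_Ints less.IH) auto
  moreover have "squarefree_series a $ m \<in> \<int>"
    using assms(1) by (auto simp: squarefree_series_nth intro: Ints_diff Ints_power)
  ultimately show ?case by (auto intro: Ints_diff Ints_sum)
qed

section \<open>Necklace binomials at negative arguments\<close>

lemma gchoose_pos:
  fixes a :: real
  assumes "real c - 1 < a"
  shows "0 < a gchoose c"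
  unfolding gbinomial_prod_rev using assms by (intro divide_pos_pos prod_pos) auto

lemma gchoose_neg_sign:
  fixes a :: real
  assumes "a < 0"
  shows "0 < (- 1) ^ c * (a gchoose c)"
proof -
  have "(- 1) ^ c * (a gchoose c) = (real c - a - 1) gchoose c"
    by (subst gbinomial_negated_upper) (simp flip: mult.assoc power_mult_distrib)
  also have "\<dots> > 0" using assms by (intro gchoose_pos) simp
  finally show ?thesis .
qed

lemma less_if_mult_add_1_less:
  fixes a t :: real
  assumes "a * (a + 1) < t * (t + 1)" "t \<ge> 0"
  shows "a < t"
proof (rule ccontr)
  assume "\<not> a < t"
  then have "t * (t + 1) \<le> a * (a + 1)" using assms(2) by (intro mult_mono) auto
  with assms(1) show False by simp
qed

definition signed_necklace_choose :: "nat \<Rightarrow> nat \<Rightarrow> real \<Rightarrow> real" where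
  "signed_necklace_choose i c t = (- 1) ^ (i * c) * (necklace_poly i (- t) gchoose c)"

lemma signed_necklace_choose_pos_odd:
  assumes "odd i" "primitive_words i t > 0"
  shows "0 < signed_necklace_choose i c t"
proof -
  have "necklace_poly i (- t) < 0"
    using assms odd_pos[OF assms(1)] by (simp add: necklace_poly_def primitive_words_uminus_odd)
  then show ?thesis
    using gchoose_neg_sign assms(1) by (simp add: signed_necklace_choose_def power_mult)
qed

lemma signed_necklace_choose_pos_even:
  assumes "even i" "i > 0" "real i * (real c - 1) < primitive_words i (- t)"
  shows "0 < signed_necklace_choose i c t"
proof -
  have "real c - 1 < necklace_poly i (- t)"
    using assms by (simp add: necklace_poly_def field_simps)
  then show ?thesis
    using gchoose_pos assms(1) by (simp add: signed_necklace_choose_def power_mult)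
qed

lemma primitive_words_uminus_even_lower:
  fixes t :: real
  assumes "even i" "i \<ge> 4" "t \<ge> 1"
  shows "t\<^sup>2 * (t\<^sup>2 - 1) \<le> primitive_words i (- t)"
proof -
  obtain m where m: "i = 2 * m" using assms(1) by (rule evenE)
  with assms(2) have "m \<ge> 2" by simp
  have "t\<^sup>2 * (t\<^sup>2 - 1) = primitive_words 2 (t\<^sup>2)"
    by (simp add: primitive_words_2 right_diff_distrib power2_eq_square)
  also have "\<dots> \<le> primitive_words m (t\<^sup>2)"
    using \<open>m \<ge> 2\<close> assms(3) by (intro primitive_words_2_le) (auto simp: one_le_power)
  also have "\<dots> \<le> primitive_words i (- t)"
    using \<open>m \<ge> 2\<close> assms(3) primitive_words_nonneg[of m t]
    by (simp add: m primitive_words_uminus_double)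
  finally show ?thesis .
qed

text \<open>A second part of size at least \<open>4\<close> forces \<open>n \<ge> 8\<close>, hence \<open>t > 2\<close>, where \<open>M\<^sub>i(-t)\<close> is large.\<close>

lemma primitive_words_uminus_even_gt:
  fixes t :: real
  assumes "even i" "i \<ge> 4" "t > 1" "t * (t + 1) > real n - 2" "i * c \<le> n"
  shows "real i * (real c - 1) < primitive_words i (- t)"
proof (cases "c \<le> 1")
  case True
  then have "real i * (real c - 1) \<le> 0" by (intro mult_nonneg_nonpos) auto
  also have "0 < t\<^sup>2 * (t\<^sup>2 - 1)" using assms(3) by (simp add: one_less_power)
  also have "\<dots> \<le> primitive_words i (- t)"
    using assms by (intro primitive_words_uminus_even_lower) auto
  finally show ?thesis .
next
  case False
  then have "4 * 2 \<le> i * c" using assms(2) by (intro mult_mono) auto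
  with assms(5) have "n \<ge> 8" by linarith
  with assms(4) have "2 * (2 + 1) < t * (t + 1)" by simp
  then have "t > 2" using assms(3) by (intro less_if_mult_add_1_less[of 2 t]) auto
  have "real i * real c \<le> real n" using assms(5) by (metis of_nat_le_iff of_nat_mult)
  then have "real i * (real c - 1) < t * (t + 1)"
    using assms(2,4) by (simp add: right_diff_distrib)
  also have "\<dots> * 1 \<le> \<dots> * (t * (t - 1))"
    using \<open>t > 2\<close> mult_mono[of 1 t 1 "t - 1"] by (intro mult_left_mono) auto
  also have "\<dots> = t\<^sup>2 * (t\<^sup>2 - 1)"
    by (simp add: algebra_simps power2_eq_square)
  also have "\<dots> \<le> primitive_words i (- t)"
    using assms by (intro primitive_words_uminus_even_lower) auto
  finally show ?thesis by simp
qed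

lemma signed_necklace_choose_pos:
  assumes t: "t > 0" "t * (t + 1) > real n - 2" "n = 3 \<Longrightarrow> t > 1"
    and i: "i \<in> {1..n}" "i * c \<le> n"
  shows "0 < signed_necklace_choose i c t"
proof -
  have "t > 1" if "i \<ge> 3"
  proof (cases "n = 3")
    case False
    with that i(1) t(2) have "1 * (1 + 1) < t * (t + 1)" by simp
    then show ?thesis using t(1) by (intro less_if_mult_add_1_less[of 1 t]) auto
  qed (rule t(3))
  show ?thesis
  proof (cases "even i")
    case False
    have "primitive_words i t > 0"
      using \<open>i \<ge> 3 \<Longrightarrow> t > 1\<close> t(1) i(1) False primitive_words_pos[of i t]
      by (cases "i = 1") (auto elim!: oddE)
    with False show ?thesis by (rule signed_necklace_choose_pos_odd)
  next
    case True
    have "real i * (real c - 1) < primitive_words i (- t)"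
    proof (cases "i = 2")
      case True
      then show ?thesis
        using t(2) i(2) by (simp add: primitive_words_2 algebra_simps power2_eq_square)
    next
      case False
      with \<open>even i\<close> i(1) have "i \<ge> 4" by (auto elim!: evenE)
      with \<open>even i\<close> \<open>i \<ge> 3 \<Longrightarrow> t > 1\<close> t(2) i(2) show ?thesis
        by (intro primitive_words_uminus_even_gt) auto
    qed
    with True i(1) show ?thesis by (intro signed_necklace_choose_pos_even) auto
  qed
qed

lemma signed_necklace_choose_nonneg:
  assumes "k \<ge> 1" "i > 0"
  shows "0 \<le> signed_necklace_choose i c (real k)"
proof (cases "even i")
  case False
  have "primitive_words i (real k) \<ge> 0" using assms by (intro primitive_words_nonneg) auto
  then consider "necklace_poly i (- real k) < 0" | "necklace_poly i (- real k) = 0"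
    using False assms(2) by (force simp: necklace_poly_def primitive_words_uminus_odd)
  then show ?thesis
  proof cases
    case 1
    then show ?thesis using gchoose_neg_sign[of "necklace_poly i (- real k)" c] False
      by (simp add: signed_necklace_choose_def power_mult)
  qed (simp add: signed_necklace_choose_def gbinomial_0_left)
next
  case True
  then obtain m where m: "i = 2 * m" by (rule evenE)
  have "primitive_words i (- real k) \<ge> 0"
    using assms primitive_words_nonneg[of m "real k"] primitive_words_nonneg[of m "(real k)\<^sup>2"]
    by (simp add: m primitive_words_uminus_double one_le_power)
  then have "necklace_poly i (- real k) \<ge> 0" by (simp add: necklace_poly_def)
  moreover have "necklace_poly i (- real k) \<in> \<int>"
    using assms(2) by (intro necklace_poly_Ints) auto
  ultimately obtain j where "necklace_poly i (- real k) = real j"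
    by (metis Ints_cases of_int_of_nat_eq of_int_0_le_iff zero_le_imp_eq_int)
  then show ?thesis
    using True by (simp add: signed_necklace_choose_def power_mult flip: binomial_gbinomial)
qed

lemma tendsto_power_divide_at_infinity:
  assumes "m \<le> n"
  shows "((\<lambda>x::real. x ^ m / x ^ n) \<longlongrightarrow> (if m = n then 1 else 0)) at_infinity"
proof (cases "m = n")
  case True
  have "\<forall>\<^sub>F x::real in at_infinity. x ^ m / x ^ n = 1"
    by (rule eventually_at_infinityI[of 1]) (auto simp: True)
  with True show ?thesis by (simp add: tendsto_eventually)
next
  case False
  with assms show ?thesis
    using poly_divide_tendsto_0_at_infinity[of "monom 1 m :: real poly" "monom 1 n"]
    by (simp add: degree_monom_eq poly_monom)
qed

lemma tendsto_necklace_poly_at_infinity: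
  assumes "i > 0"
  shows "((\<lambda>x::real. necklace_poly i x / x ^ i) \<longlongrightarrow> 1 / real i) at_infinity"
proof -
  have "((\<lambda>x::real. (\<Sum>d | d dvd i. of_int (moebius_mu d) * (x ^ (i div d) / x ^ i)) / real i)
      \<longlongrightarrow> (\<Sum>d | d dvd i. of_int (moebius_mu d) * (if i div d = i then 1 else 0)) / real i)
      at_infinity"
    using assms by (intro tendsto_intros tendsto_power_divide_at_infinity) auto
  also have "(\<Sum>d | d dvd i. of_int (moebius_mu d) * (if i div d = i then 1 else 0)) =
      (\<Sum>d | d dvd i. if d = 1 then 1 else 0 :: real)"
    using assms by (intro sum.cong) (auto simp: div_eq_dividend_iff)
  finally show ?thesis
    using assms by (simp add: necklace_poly_def primitive_words_def moebius_transform_def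
        sum_divide_distrib mult.commute)
qed

lemma signed_necklace_choose_eq_prod:
  "signed_necklace_choose i c t / t ^ (i * c) =
    (\<Prod>j = 0..<c. necklace_poly i (- t) / (- t) ^ i - real j / (- t) ^ i) / fact c"
proof -
  have "(\<Prod>j = 0..<c. necklace_poly i (- t) / (- t) ^ i - real j / (- t) ^ i) =
      (\<Prod>j = 0..<c. necklace_poly i (- t) - real j) / (- t) ^ (i * c)"
    by (simp add: prod_dividef power_mult flip: diff_divide_distrib)
  also have "\<dots> = (- 1) ^ (i * c) * (\<Prod>j = 0..<c. necklace_poly i (- t) - real j) / t ^ (i * c)"
    by (subst power_minus) (cases "even (i * c)", auto)
  finally show ?thesis by (simp add: signed_necklace_choose_def gbinomial_prod_rev)
qed

lemma tendsto_signed_necklace_choose: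
  assumes "i > 0"
  shows "((\<lambda>t. signed_necklace_choose i c t / t ^ (i * c)) \<longlongrightarrow> 1 / (real i ^ c * fact c)) at_top"
proof -
  have neg: "filterlim (\<lambda>t::real. - t) at_infinity at_top"
    using filterlim_mono[OF filterlim_uminus_at_bot_at_top at_bot_le_at_infinity order_refl] .
  have "((\<lambda>t::real. real j / (- t) ^ i) \<longlongrightarrow> 0) at_top" for j
    using assms by (intro tendsto_divide_0[OF tendsto_const]
        filterlim_compose[OF filterlim_power_at_infinity neg]) simp
  then have "((\<lambda>t::real.
        (\<Prod>j = 0..<c. necklace_poly i (- t) / (- t) ^ i - real j / (- t) ^ i) / fact c)
      \<longlongrightarrow> (\<Prod>j = 0..<c. 1 / real i - 0) / fact c) at_top"
    using filterlim_compose[OF tendsto_necklace_poly_at_infinity[OF assms] neg]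
    by (intro tendsto_divide[OF tendsto_prod tendsto_const] tendsto_diff) auto
  then show ?thesis
    unfolding signed_necklace_choose_eq_prod by (simp add: power_one_over)
qed

section \<open>The measure\<close>

definition nu_class_real :: "nat \<Rightarrow> real \<Rightarrow> nat multiset \<Rightarrow> real" where
  "nu_class_real n x \<mu> = squarefree_count x \<mu> / (x ^ (n - 1) * (x - 1))"

definition nu_real :: "nat \<Rightarrow> real \<Rightarrow> (nat \<Rightarrow> nat) \<Rightarrow> real" where
  "nu_real n x g =
    nu_class_real n x (cycle_type n g) / real (card (conj_class n (cycle_type n g)))"

lemma necklace_of_real: "necklace m (of_real x) = of_real (necklace_poly m x)"
  by (simp add: necklace_def necklace_poly_def primitive_words_def moebius_transform_def)

lemma of_real_gchoose:
  "of_real (a gchoose c) = (of_real a gchoose c :: 'a :: {real_field, field_char_0})"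
  by (simp add: gbinomial_prod_rev)

lemma nu_class_of_real:
  assumes "\<mu> \<in> partitions n"
  shows "nu_class n (of_real x) \<mu> = of_real (nu_class_real n x \<mu>)"
  using squarefree_count_superset[OF _ partitions_parts[OF assms], of x]
  by (simp add: nu_class_def nu_class_real_def necklace_of_real of_real_gchoose)

lemma nu_of_real:
  assumes "g \<in> Sn n"
  shows "nu n (of_real x) g = of_real (nu_real n x g)"
  by (simp add: nu_def nu_real_def nu_class_of_real[OF cycle_type_in_partitions[OF assms]])

lemma sum_nu_real:
  assumes "n \<ge> 2" "x \<noteq> 0" "x \<noteq> 1"
  shows "(\<Sum>g\<in>Sn n. nu_real n x g) = 1"
proof -
  have "(\<Sum>g\<in>Sn n. nu_real n x g) = (\<Sum>\<mu>\<in>partitions n. nu_class_real n x \<mu>)"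
    unfolding nu_real_def by (rule sum_Sn_average_over_conj_class)
  also have "\<dots> = squarefree_series x $ n / (x ^ (n - 1) * (x - 1))"
    by (simp add: nu_class_real_def sum_squarefree_count flip: sum_divide_distrib)
  also have "squarefree_series x $ n = x ^ (n - 1) * (x - 1)"
    using assms(1) by (cases n) (simp_all add: squarefree_series_nth algebra_simps)
  finally show ?thesis using assms by simp
qed

lemma pmf_of_finite_weights:
  fixes w :: "'a \<Rightarrow> real"
  assumes "finite A" "\<And>x. x \<in> A \<Longrightarrow> 0 \<le> w x" "sum w A = 1"
  obtains p where "\<And>x. x \<in> A \<Longrightarrow> pmf p x = w x" "set_pmf p = {x \<in> A. w x \<noteq> 0}"
proof -
  define v where "v x = (if x \<in> A then w x else 0)" for x
  have nonneg: "0 \<le> v x" for x using assms(2) by (simp add: v_def)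
  have "(\<integral>\<^sup>+ x. ennreal (v x) \<partial>count_space UNIV) = (\<Sum>x\<in>A. ennreal (v x))"
    by (intro nn_integral_count_space' assms(1)) (auto simp: v_def)
  also have "\<dots> = ennreal (sum v A)" by (simp add: sum_ennreal nonneg)
  also have "\<dots> = 1" using assms(3) by (simp add: v_def)
  finally have "pmf (embed_pmf v) x = v x" for x
    using nonneg by (intro pmf_embed_pmf)
  then show ?thesis
    by (intro that[of "embed_pmf v"]) (auto simp: v_def set_pmf_eq)
qed

lemma ex_pmf_of_nu:
  assumes "n \<ge> 2" "x \<noteq> 0" "x \<noteq> 1" "\<And>g. g \<in> Sn n \<Longrightarrow> 0 \<le> nu_real n x g"
  shows "\<exists>p. is_pmf_of_nu n (of_real x) p \<and> set_pmf p = {g \<in> Sn n. nu_real n x g \<noteq> 0}"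
proof -
  obtain p where "\<And>g. g \<in> Sn n \<Longrightarrow> pmf p g = nu_real n x g"
    "set_pmf p = {g \<in> Sn n. nu_real n x g \<noteq> 0}"
    using pmf_of_finite_weights[OF finite_Sn assms(4) sum_nu_real[OF assms(1-3)]] by blast
  then show ?thesis by (auto simp: is_pmf_of_nu_def nu_of_real)
qed

text \<open>The sign \<open>(-1)\<^sup>n\<close> of the denominator is distributed over the parts, as they add up to \<open>n\<close>.\<close>

lemma nu_class_real_uminus:
  assumes "\<mu> \<in> partitions n" "n > 0"
  shows "nu_class_real n (- t) \<mu> =
    (\<Prod>i\<in>set_mset \<mu>. signed_necklace_choose i (count \<mu> i) t) / (t ^ (n - 1) * (t + 1))"
proof -
  have "(\<Prod>i\<in>set_mset \<mu>. (- 1) ^ (i * count \<mu> i)) = (- 1 :: real) ^ n"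
    using assms(1) by (simp add: sum_mult_count_eq_sum_mset partitions_def flip: power_sum)
  moreover have "(- t) ^ (n - 1) * (- t - 1) = (- 1) ^ n * (t ^ (n - 1) * (t + 1))"
    using assms(2) by (cases n) (simp_all add: power_minus[of t] algebra_simps)
  moreover have "a / ((- 1) ^ n * b) = (- 1) ^ n * a / b" for a b :: real
    by (cases "even n") auto
  ultimately show ?thesis
    by (simp add: nu_class_real_def squarefree_count_def signed_necklace_choose_def prod.distrib)
qed

lemma nu_real_uminus_pos:
  assumes "g \<in> Sn n" "n > 0" "t > 0" "t * (t + 1) > real n - 2" "n = 3 \<Longrightarrow> t > 1"
  shows "0 < nu_real n (- t) g"
proof -
  have \<mu>: "cycle_type n g \<in> partitions n" using assms(1) by (rule cycle_type_in_partitions)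
  have "0 < signed_necklace_choose i (count (cycle_type n g) i) t" if "i \<in># cycle_type n g" for i
    using assms that partitions_parts[OF \<mu>] partitions_mult_count_le[OF \<mu>]
    by (intro signed_necklace_choose_pos) auto
  then show ?thesis
    unfolding nu_real_def nu_class_real_uminus[OF \<mu> assms(2)] using assms card_conj_class_pos[OF \<mu>]
    by (intro divide_pos_pos prod_pos mult_pos_pos) auto
qed

lemma nu_real_uminus_nonneg:
  assumes "g \<in> Sn n" "n > 0" "k \<ge> 1"
  shows "0 \<le> nu_real n (- real k) g"
proof -
  have \<mu>: "cycle_type n g \<in> partitions n" using assms(1) by (rule cycle_type_in_partitions)
  have "0 \<le> signed_necklace_choose i (count (cycle_type n g) i) (real k)"
    if "i \<in># cycle_type n g" for i
    using assms that partitions_parts[OF \<mu>] by (intro signed_necklace_choose_nonneg) auto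
  then show ?thesis
    unfolding nu_real_def nu_class_real_uminus[OF \<mu> assms(2)]
    by (intro divide_nonneg_nonneg prod_nonneg) auto
qed

lemma nu_full_support:
  assumes "n \<ge> 2" "t > 0" "t * (t + 1) > real n - 2" "n = 3 \<longrightarrow> t > 1"
  shows "\<And>g. g \<in> Sn n \<Longrightarrow> nu n (- of_real t) g \<in> \<real> \<and> Re (nu n (- of_real t) g) > 0"
    and "\<exists>p. is_pmf_of_nu n (- of_real t) p \<and> set_pmf p = Sn n"
proof -
  have pos: "0 < nu_real n (- t) g" if "g \<in> Sn n" for g
    using that assms by (intro nu_real_uminus_pos) auto
  then show "nu n (- of_real t) g \<in> \<real> \<and> Re (nu n (- of_real t) g) > 0" if "g \<in> Sn n" for g
    using nu_of_real[OF that, of "- t"] that by simp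
  have "{g \<in> Sn n. nu_real n (- t) g \<noteq> 0} = Sn n" using pos by fastforce
  then show "\<exists>p. is_pmf_of_nu n (- of_real t) p \<and> set_pmf p = Sn n"
    using ex_pmf_of_nu[of n "- t"] assms pos by (force simp: less_imp_le)
qed

lemma nu_class_vanishes:
  assumes "\<mu> \<in> partitions n" "count \<mu> 2 = n div 2" "k \<ge> 1" "k * (k + 1) \<le> n - 2"
  shows "nu_class n (- of_nat k) \<mu> = 0"
proof -
  have "even (k * (k + 1))" by simp
  then obtain j where j: "k * (k + 1) = 2 * j" by (rule evenE)
  then have "necklace_poly 2 (- real k) = real j"
    by (simp add: necklace_poly_def primitive_words_2 power2_eq_square algebra_simps
        flip: of_nat_mult of_nat_add)
  moreover have "j < count \<mu> 2"
    using assms(2-4) j by (cases "n \<ge> 2") auto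
  moreover from this have "2 \<in># \<mu>" by (metis not_in_iff not_less0)
  ultimately have "squarefree_count (- real k) \<mu> = 0"
    by (auto simp: squarefree_count_def binomial_eq_0 simp flip: binomial_gbinomial
        intro!: bexI[of _ 2])
  then show ?thesis
    using nu_class_of_real[OF assms(1), of "- real k"] by (simp add: nu_class_real_def)
qed

definition two_cycle_type :: "nat \<Rightarrow> nat multiset" where
  "two_cycle_type n = (if even n then replicate_mset (n div 2) 2
    else add_mset 1 (replicate_mset ((n - 1) div 2) 2))"

lemma two_cycle_type_in_partitions: "two_cycle_type n \<in> partitions n"
  by (auto simp: two_cycle_type_def partitions_def sum_mset_replicate_mset
      split: if_splits elim!: oddE)

lemma count_two_cycle_type: "count (two_cycle_type n) 2 = n div 2"
  by (auto simp: two_cycle_type_def elim!: oddE)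

lemma nu_negative_integer:
  assumes "n \<ge> 2" "k \<ge> 1" "k * (k + 1) \<le> n - 2"
  shows "\<And>g. g \<in> Sn n \<Longrightarrow> nu n (- of_nat k) g \<in> \<real> \<and> Re (nu n (- of_nat k) g) \<ge> 0"
    and "nu_class n (- of_nat k) (two_cycle_type n) = 0"
    and "\<And>g. g \<in> conj_class n (two_cycle_type n) \<Longrightarrow> nu n (- of_nat k) g = 0"
    and "\<exists>p. is_pmf_of_nu n (- of_nat k) p \<and> set_pmf p \<noteq> Sn n"
proof -
  have nu_eq: "nu n (- of_nat k) g = of_real (nu_real n (- real k) g)" if "g \<in> Sn n" for g
    using nu_of_real[OF that, of "- real k"] by simp
  have nonneg: "0 \<le> nu_real n (- real k) g" if "g \<in> Sn n" for g
    using that assms by (intro nu_real_uminus_nonneg) auto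
  then show "nu n (- of_nat k) g \<in> \<real> \<and> Re (nu n (- of_nat k) g) \<ge> 0" if "g \<in> Sn n" for g
    using that by (simp add: nu_eq)
  show vanishes: "nu_class n (- of_nat k) (two_cycle_type n) = 0"
    using two_cycle_type_in_partitions count_two_cycle_type assms(2,3) by (rule nu_class_vanishes)
  show zero: "nu n (- of_nat k) g = 0" if "g \<in> conj_class n (two_cycle_type n)" for g
    using that vanishes by (auto simp: nu_def conj_class_def)
  obtain g where "g \<in> conj_class n (two_cycle_type n)"
    using card_conj_class_pos[OF two_cycle_type_in_partitions] by (fastforce simp: card_gt_0_iff)
  then have "g \<in> Sn n" "nu_real n (- real k) g = 0"
    using zero[of g] nu_eq[of g] by (auto simp: conj_class_def)
  then show "\<exists>p. is_pmf_of_nu n (- of_nat k) p \<and> set_pmf p \<noteq> Sn n"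
    using ex_pmf_of_nu[of n "- real k", OF assms(1) _ _ nonneg] assms(2) by auto
qed

lemma tendsto_nu_class_real:
  assumes "\<mu> \<in> partitions n" "n > 0"
  shows "((\<lambda>t. nu_class_real n (- t) \<mu>) \<longlongrightarrow> 1 / real (centralizer_size \<mu>)) at_top"
proof -
  let ?f = "\<lambda>t. \<Prod>i\<in>set_mset \<mu>. signed_necklace_choose i (count \<mu> i) t / t ^ (i * count \<mu> i)"
  have "(?f \<longlongrightarrow> (\<Prod>i\<in>set_mset \<mu>. 1 / (real i ^ count \<mu> i * fact (count \<mu> i)))) at_top"
    using partitions_parts[OF assms(1)] by (intro tendsto_prod tendsto_signed_necklace_choose) auto
  moreover have "((\<lambda>t::real. t / (t + 1)) \<longlongrightarrow> 1) at_top"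
    by real_asymp
  ultimately have "((\<lambda>t. ?f t * (t / (t + 1))) \<longlongrightarrow>
      (\<Prod>i\<in>set_mset \<mu>. 1 / (real i ^ count \<mu> i * fact (count \<mu> i))) * 1) at_top"
    by (rule tendsto_mult)
  also have "(\<Prod>i\<in>set_mset \<mu>. 1 / (real i ^ count \<mu> i * fact (count \<mu> i))) * 1 =
      1 / real (centralizer_size \<mu>)"
    by (simp add: centralizer_size_def prod_dividef)
  finally have "((\<lambda>t. ?f t * (t / (t + 1))) \<longlongrightarrow> 1 / real (centralizer_size \<mu>)) at_top" .
  moreover have "\<forall>\<^sub>F t in at_top. ?f t * (t / (t + 1)) = nu_class_real n (- t) \<mu>"
    using eventually_gt_at_top[of 0]
  proof eventually_elim
    case (elim t)
    have "(\<Prod>i\<in>set_mset \<mu>. t ^ (i * count \<mu> i)) = t ^ n"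
      using assms(1) by (simp add: sum_mult_count_eq_sum_mset partitions_def flip: power_sum)
    also have "\<dots> = t * t ^ (n - 1)" using assms(2) by (cases n) auto
    finally show ?case
      using elim by (simp add: nu_class_real_uminus[OF assms] prod_dividef)
  qed
  ultimately show ?thesis by (rule Lim_transform_eventually)
qed

lemma tendsto_nu:
  assumes "g \<in> Sn n" "n > 0"
  shows "((\<lambda>t::real. nu n (- of_real t) g) \<longlongrightarrow> 1 / fact n) at_top"
proof -
  let ?\<mu> = "cycle_type n g" and ?C = "conj_class n (cycle_type n g)"
  have \<mu>: "?\<mu> \<in> partitions n" using assms(1) by (rule cycle_type_in_partitions)
  have class_equation: "real (card ?C) * real (centralizer_size ?\<mu>) = fact n"
    using card_conj_class_mult_centralizer_size[OF \<mu>] by (metis of_nat_fact of_nat_mult)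
  have "((\<lambda>t. nu_real n (- t) g) \<longlongrightarrow> 1 / real (centralizer_size ?\<mu>) / real (card ?C)) at_top"
    unfolding nu_real_def using card_conj_class_pos[OF \<mu>]
    by (intro tendsto_divide tendsto_const tendsto_nu_class_real[OF \<mu> assms(2)]) simp
  also have "1 / real (centralizer_size ?\<mu>) / real (card ?C) = 1 / fact n"
    by (simp add: class_equation[symmetric] mult.commute)
  finally have "((\<lambda>t. complex_of_real (nu_real n (- t) g)) \<longlongrightarrow> of_real (1 / fact n)) at_top"
    by (rule tendsto_of_real)
  then show ?thesis
    by (simp add: nu_of_real[OF assms(1)] flip: of_real_minus)
qed

theorem theorem4p7:
  fixes n :: nat
  assumes "n \<ge> 2"
  shows
    "(\<forall>t::real. t > 0 \<and> t * (t + 1) > real n - 2 \<and> (n = 3 \<longrightarrow> t > 1) \<longrightarrow>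
        (\<forall>g \<in> Sn n. nu n (- complex_of_real t) g \<in> \<real> \<and> Re (nu n (- complex_of_real t) g) > 0) \<and>
        (\<exists>p. is_pmf_of_nu n (- complex_of_real t) p \<and> set_pmf p = Sn n)) \<and>
     (\<forall>k::nat. k \<ge> 1 \<and> k * (k + 1) \<le> n - 2 \<longrightarrow>
        (\<forall>g \<in> Sn n. nu n (- of_nat k) g \<in> \<real> \<and> Re (nu n (- of_nat k) g) \<ge> 0) \<and>
        (\<exists>p. is_pmf_of_nu n (- of_nat k) p \<and> set_pmf p \<noteq> Sn n) \<and>
        (let \<mu> = (if even n then replicate_mset (n div 2) 2
                  else add_mset 1 (replicate_mset ((n - 1) div 2) 2))
         in nu_class n (- of_nat k) \<mu> = 0 \<and> (\<forall>g \<in> conj_class n \<mu>. nu n (- of_nat k) g = 0))) \<and>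
     (\<forall>g \<in> Sn n.
        ((\<lambda>t::real. nu n (- complex_of_real t) g) \<longlongrightarrow> 1 / fact n) at_top)"
  unfolding two_cycle_type_def[symmetric] Let_def
proof (intro conjI allI impI ballI; (elim conjE)?)
  fix t :: real assume "t > 0" "t * (t + 1) > real n - 2" "n = 3 \<longrightarrow> t > 1"
  note nu_t = nu_full_support[OF assms this]
  show "nu n (- of_real t) g \<in> \<real>" "Re (nu n (- of_real t) g) > 0" if "g \<in> Sn n" for g
    using nu_t(1)[OF that] by simp_all
  show "\<exists>p. is_pmf_of_nu n (- of_real t) p \<and> set_pmf p = Sn n" by (fact nu_t(2))
next
  fix k :: nat assume "k \<ge> 1" "k * (k + 1) \<le> n - 2"
  note nu_k = nu_negative_integer[OF assms this]
  show "nu_class n (- of_nat k) (two_cycle_type n) = 0"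
    "\<exists>p. is_pmf_of_nu n (- of_nat k) p \<and> set_pmf p \<noteq> Sn n"
    by (fact nu_k(2,4))+
  show "nu n (- of_nat k) g \<in> \<real>" "Re (nu n (- of_nat k) g) \<ge> 0" if "g \<in> Sn n" for g
    using nu_k(1)[OF that] by simp_all
  show "nu n (- of_nat k) g = 0" if "g \<in> conj_class n (two_cycle_type n)" for g
    using that by (rule nu_k(3))
next
  show "((\<lambda>t::real. nu n (- of_real t) g) \<longlongrightarrow> 1 / fact n) at_top" if "g \<in> Sn n" for g
    using that assms by (intro tendsto_nu) auto
qed

end
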